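(* For all $n\times n$ complex positive definite matrices $A_1,\dots,A_m$ and all weights $w=(w_1,\dots,w_m)$ (i.e. $w_j\ge 0$ and $\sum_{j=1}^m w_j=1$), we have $$\|Q_{1/2}(w;A_1,\dots,A_m)\|_p\le\|\Omega(w;A_1,\dots,A_m)\|_p$$ for the Schatten $p$-norms with $p=1$ and $p=\infty$. In the case $m=2$, this inequality holds also with $p=2$.
   Context: $\mathbb{P}$ denotes the space of $n\times n$ complex positive definite matrices; for $A\in\mathbb{P}$, $A^{1/2}$ is its positive definite square root. The power mean with exponent $1/2$ is $Q_{1/2}(w;A_1,\dots,A_m)=\left(\sum_{j=1}^m w_jA_j^{1/2}\right)^2$. The Wasserstein mean $\Omega(w;A_1,\dots,A_m)$ is the unique minimizer over $X\in\mathbb{P}$ of $\sum_{j=1}^m w_j\,d^2(X,A_j)$, where $d(A,B)=\left[\mathrm{tr}(A+B)-2\,\mathrm{tr}\,(A^{1/2}BA^{1/2})^{1/2}\right]^{1/2}$ is the Bures-Wasserstein distance. Equivalently, it is the unique positive definite solution $X$ of $X=\sum_{j=1}^m w_j(X^{1/2}A_jX^{1/2})^{1/2}$. For $m=2$, $(A_1,A_2)=(A,B)$ and $(w_1,w_2)=(1-t,t)$ with $0\le t\le 1$, it is given explicitly by $(1-t)^2A+t^2B+t(1-t)\left[(AB)^{1/2}+(BA)^{1/2}\right]$, where $(AB)^{1/2}$ is the unique square root of $AB$ with positive eigenvalues (and likewise for $(BA)^{1/2}$). The Schatten $p$-norm $\|X\|_p$ is the $\ell^p$ norm of the tuple of singular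 values of $X$; $\|X\|_\infty$ is the operator norm. *)

theory Defs
  imports "HOL-Analysis.Analysis" "HOL-Computational_Algebra.Polynomial"
begin

definition conj_transpose :: "complex^'n^'m \<Rightarrow> complex^'m^'n" where
  "conj_transpose A = (\<chi> i j. cnj (A $ j $ i))"

definition pos_def_mat :: "complex^'n^'n \<Rightarrow> bool" where
  "pos_def_mat A \<longleftrightarrow> conj_transpose A = A \<and>
     (\<forall>x. x \<noteq> 0 \<longrightarrow> 0 < Re (\<Sum>i\<in>UNIV. cnj (x $ i) * (A *v x) $ i))"

text \<open>Only meaningful for positive definite arguments, where the positive definite
  square root exists and is unique.\<close>
definition pd_sqrt :: "complex^'n^'n \<Rightarrow> complex^'n^'n" where
  "pd_sqrt A = (THE B. pos_def_mat B \<and> B ** B = A)"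

definition charpoly :: "complex^'n^'n \<Rightarrow> complex poly" where
  "charpoly A = det (\<chi> i j. (if i = j then [:0, 1:] else 0) - [:A $ i $ j:])"

text \<open>The square roots of the eigenvalues of $X^* X$, which are real and nonnegative,
  counted with algebraic multiplicity.\<close>
definition singular_values :: "complex^'n^'n \<Rightarrow> real multiset" where
  "singular_values X =
     image_mset (\<lambda>\<mu>. sqrt (Re \<mu>)) (proots (charpoly (conj_transpose X ** X)))"

text \<open>Meant for $1 \le p \le \infty$. The norm on complex vectors underlying
  \<^const>\<open>onorm\<close> is the Euclidean one.\<close>
definition schatten_norm :: "ereal \<Rightarrow> complex^'n^'n \<Rightarrow> real" where
  "schatten_norm p X =
     (if p = \<infinity> then onorm (\<lambda>v. X *v v)
      else (\<Sum>s\<in>#singular_values X. s powr real_of_ereal p) powr (1 / real_of_ereal p))"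

definition power_mean_half ::
  "nat \<Rightarrow> (nat \<Rightarrow> real) \<Rightarrow> (nat \<Rightarrow> complex^'n^'n) \<Rightarrow> complex^'n^'n" where
  "power_mean_half m w A =
     (let S = (\<Sum>j=1..m. w j *\<^sub>R pd_sqrt (A j)) in S ** S)"

definition bures_wasserstein_dist :: "complex^'n^'n \<Rightarrow> complex^'n^'n \<Rightarrow> real" where
  "bures_wasserstein_dist A B =
     sqrt (Re (trace (A + B) - 2 * trace (pd_sqrt (pd_sqrt A ** B ** pd_sqrt A))))"

text \<open>The unique minimizer over the cone of positive definite matrices.\<close>
definition wasserstein_mean ::
  "nat \<Rightarrow> (nat \<Rightarrow> real) \<Rightarrow> (nat \<Rightarrow> complex^'n^'n) \<Rightarrow> complex^'n^'n" where
  "wasserstein_mean m w A =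
     (THE X. is_arg_min (\<lambda>X. \<Sum>j=1..m. w j * (bures_wasserstein_dist X (A j))\<^sup>2)
               pos_def_mat X)"

end

theory Submission
  imports Defs
begin

text \<open>
  For positive definite \<open>X\<close>, \<open>A\<close> let \<open>G\<close> be the positive definite solution of \<open>G X G = A\<close>; then
  \<open>d(X, A)\<^sup>2 = tr X + tr A - 2 tr X G\<close>. Brouwer's theorem, applied to
  \<open>X \<mapsto> \<Sum>\<^sub>j w\<^sub>j (X\<^bsup>1/2\<^esup> A\<^sub>j X\<^bsup>1/2\<^esup>)\<^bsup>1/2\<^esup>\<close> on an order interval \<open>a I \<le> X \<le> b I\<close>, gives \<open>\<Omega>\<close> and
  \<open>G\<^sub>j\<close> with \<open>G\<^sub>j \<Omega> G\<^sub>j = A\<^sub>j\<close> and \<open>\<Sum>\<^sub>j w\<^sub>j G\<^sub>j = I\<close>. If \<open>H X H = G \<Omega> G\<close> then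
  \<open>2 tr X H \<le> tr X G + tr \<Omega> G\<close> with equality only for \<open>H = G\<close>, so \<open>\<Omega>\<close> is the unique minimizer.

  Write \<open>P\<^sub>j = A\<^sub>j\<^bsup>1/2\<^esup>\<close> and \<open>S = \<Sum>\<^sub>j w\<^sub>j P\<^sub>j\<close>. For \<open>p = 1\<close>, average
  \<open>2 tr S P\<^sub>j \<le> tr S\<^sup>2 G\<^sub>j + tr \<Omega> G\<^sub>j\<close>. For \<open>p = \<infinity>\<close>, \<open>\<Omega> \<le> \<mu> I\<close> gives
  \<open>P\<^sub>j\<^sup>2 \<le> \<mu> G\<^sub>j\<^sup>2\<close>, hence \<open>P\<^sub>j \<le> \<mu>\<^bsup>1/2\<^esup> G\<^sub>j\<close> by monotonicity of the square root, and averaging gives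
  \<open>S \<le> \<mu>\<^bsup>1/2\<^esup> I\<close>. For \<open>m = p = 2\<close>, with \<open>G A G = B\<close>, the mean is \<open>(a I + b G) A (a I + b G)\<close>, and
  \<open>tr \<Omega>\<^sup>2\<close> dominates \<open>tr S\<^sup>4\<close> term by term.
\<close>

subsection \<open>Hermitian matrices\<close>

abbreviation rtr :: "complex^'n^'n \<Rightarrow> real" where "rtr X \<equiv> Re (trace X)"

text \<open>The inner product of the real Euclidean space \<open>complex^'n\<close> is the real part
  of the Hermitian form, so positivity, norms and orthogonality can all be read from one real inner
  product.\<close>

lemma inner_complex_vec: "x \<bullet> y = Re (\<Sum>i\<in>UNIV. cnj (x $ i) * y $ i)" for x y :: "complex^'n"
  by (simp add: inner_vec_def inner_complex_def)

lemma pos_def_mat_iff: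
  "pos_def_mat A \<longleftrightarrow> conj_transpose A = A \<and> (\<forall>x. x \<noteq> 0 \<longrightarrow> 0 < x \<bullet> (A *v x))"
  by (simp add: pos_def_mat_def inner_complex_vec)

lemma conj_transpose_mult: "conj_transpose (A ** B) = conj_transpose B ** conj_transpose A"
  by (simp add: conj_transpose_def matrix_matrix_mult_def vec_eq_iff mult.commute)

lemma conj_transpose_conj_transpose [simp]: "conj_transpose (conj_transpose A) = A"
  by (simp add: conj_transpose_def vec_eq_iff)

lemma conj_transpose_add: "conj_transpose (A + B) = conj_transpose A + conj_transpose B"
  by (simp add: conj_transpose_def vec_eq_iff)

lemma conj_transpose_diff: "conj_transpose (A - B) = conj_transpose A - conj_transpose B"
  by (simp add: conj_transpose_def vec_eq_iff)

lemma conj_transpose_scaleR: "conj_transpose (c *\<^sub>R A) = c *\<^sub>R conj_transpose A"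
  by (simp add: conj_transpose_def vec_eq_iff)

lemma conj_transpose_mat_1 [simp]: "conj_transpose (mat 1) = mat 1"
  by (auto simp: conj_transpose_def vec_eq_iff mat_def)

lemma inner_matrix_vector: "x \<bullet> (A *v y) = (conj_transpose A *v x) \<bullet> y"
proof -
  have "x \<bullet> (A *v y) = Re (\<Sum>i\<in>UNIV. \<Sum>j\<in>UNIV. cnj (x $ i) * (A $ i $ j * y $ j))"
    by (simp add: inner_complex_vec matrix_vector_mult_def sum_distrib_left)
  also have "\<dots> = Re (\<Sum>j\<in>UNIV. \<Sum>i\<in>UNIV. cnj (x $ i) * (A $ i $ j * y $ j))"
    by (subst sum.swap) simp
  also have "\<dots> = (conj_transpose A *v x) \<bullet> y"
    by (simp add: inner_complex_vec matrix_vector_mult_def sum_distrib_left sum_distrib_right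
        conj_transpose_def mult_ac)
  finally show ?thesis .
qed

section \<open>Bilinearity of the matrix product, traces and congruences\<close>

lemma matrix_diff_ldistrib: "A ** (B - C) = A ** B - A ** C" for A :: "'a::ring_1^'n^'m"
  by (simp add: matrix_matrix_mult_def vec_eq_iff right_diff_distrib sum_subtractf)

lemma matrix_diff_rdistrib: "(A - B) ** C = A ** C - B ** C" for A :: "'a::ring_1^'n^'m"
  by (simp add: matrix_matrix_mult_def vec_eq_iff left_diff_distrib sum_subtractf)

lemma matrix_add_rdistrib: "(A + B) ** C = A ** C + B ** C" for A :: "'a::ring_1^'n^'m"
  by (simp add: matrix_matrix_mult_def vec_eq_iff distrib_right sum.distrib)

lemma matrix_scaleR_left: "(c *\<^sub>R A) ** B = c *\<^sub>R (A ** B)" for A :: "complex^'n^'m"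
  by (simp add: matrix_matrix_mult_def vec_eq_iff scaleR_sum_right)

lemma matrix_scaleR_right: "A ** (c *\<^sub>R B) = c *\<^sub>R (A ** B)" for A :: "complex^'n^'m"
  by (simp add: matrix_matrix_mult_def vec_eq_iff scaleR_sum_right)

lemma matrix_vector_scaleR_right: "A *v (c *\<^sub>R x) = c *\<^sub>R (A *v x)" for A :: "complex^'n^'m"
  by (simp add: matrix_vector_mult_def vec_eq_iff scaleR_sum_right)

lemma matrix_vector_scaleR_left: "(c *\<^sub>R A) *v x = c *\<^sub>R (A *v x)" for A :: "complex^'n^'m"
  by (simp add: matrix_vector_mult_def vec_eq_iff scaleR_sum_right)

lemma matrix_sum_ldistrib: "A ** sum f S = (\<Sum>j\<in>S. A ** f j)" for A :: "complex^'n^'m"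
  by (induction S rule: infinite_finite_induct) (auto simp: matrix_add_ldistrib)

lemma matrix_sum_rdistrib: "sum f S ** A = (\<Sum>j\<in>S. f j ** A)" for A :: "complex^'n^'m"
  by (induction S rule: infinite_finite_induct) (auto simp: matrix_add_rdistrib)

lemmas matrix_ring_simps = matrix_mul_assoc matrix_add_ldistrib matrix_add_rdistrib
  matrix_diff_ldistrib matrix_diff_rdistrib matrix_scaleR_left matrix_scaleR_right

lemma trace_scaleR: "trace (c *\<^sub>R A) = c *\<^sub>R trace A" for A :: "complex^'n^'n"
  by (simp add: trace_def scaleR_sum_right)

lemma trace_sum: "trace (sum f S) = (\<Sum>j\<in>S. trace (f j :: complex^'n^'n))"
  by (induction S rule: infinite_finite_induct) (auto simp: trace_add trace_0[simplified mat_0])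

lemma trace_cyclic3: "trace (A ** B ** C) = trace (C ** A ** B)" for A :: "complex^'n^'n"
  by (metis matrix_mul_assoc trace_mul_sym)

lemma rtr_sandwich: "rtr (conj_transpose K ** J ** K) = (\<Sum>i\<in>UNIV. column i K \<bullet> (J *v column i K))"
proof -
  have "column i K \<bullet> (J *v column i K) = Re ((conj_transpose K ** J ** K) $ i $ i)" for i
    unfolding matrix_mul_assoc[symmetric]
    by (simp add: inner_complex_vec column_def conj_transpose_def matrix_matrix_mult_def
        matrix_vector_mult_def)
  then show ?thesis by (simp add: trace_def)
qed

lemma pos_def_mat_nonneg: "pos_def_mat J \<Longrightarrow> 0 \<le> x \<bullet> (J *v x)"
  by (cases "x = 0") (auto simp: pos_def_mat_iff less_imp_le)

text \<open>The source of every trace inequality below: choose \<open>J\<close> and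
  \<open>K\<close>, expand \<open>K\<^sup>* J K\<close>, and shift factors cyclically under the
  trace.\<close>

lemma rtr_sandwich_nonneg: "pos_def_mat J \<Longrightarrow> 0 \<le> rtr (conj_transpose K ** J ** K)"
  by (auto simp: rtr_sandwich intro!: sum_nonneg pos_def_mat_nonneg)

text \<open>A vanishing sum of nonnegative forms kills each column of \<open>K\<close>. This yields
  the equality cases: uniqueness of square roots and of the minimizer.\<close>

lemma rtr_sandwich_eq_0:
  assumes "pos_def_mat J" "rtr (conj_transpose K ** J ** K) = 0"
  shows "K = 0"
proof -
  have "\<forall>i\<in>UNIV. column i K \<bullet> (J *v column i K) = 0"
    using assms by (subst sum_nonneg_eq_0_iff[symmetric]) (auto simp: rtr_sandwich pos_def_mat_nonneg)
  then have "column i K = 0" for i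
    using assms(1) by (force simp: pos_def_mat_iff)
  then show ?thesis by (simp add: column_def vec_eq_iff)
qed

lemma pos_def_mat_1: "pos_def_mat (mat 1)"
  by (simp add: pos_def_mat_iff)

lemma pos_def_mat_hermitian: "pos_def_mat A \<Longrightarrow> conj_transpose A = A"
  by (simp add: pos_def_mat_def)

text \<open>The left inverse \<open>L\<close> makes \<open>K\<close> injective, so substituting
  \<open>K *v x\<close> into the form of \<open>A\<close> keeps it positive.\<close>

lemma pos_def_mat_congruence:
  assumes "pos_def_mat A" "L ** K = mat 1"
  shows "pos_def_mat (conj_transpose K ** A ** K)"
proof -
  have "K *v x \<noteq> 0" if "x \<noteq> 0" for x
    using that assms(2) by (metis matrix_vector_mul_assoc matrix_vector_mul_lid matrix_vector_mult_0_right)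
  moreover have "x \<bullet> ((conj_transpose K ** A ** K) *v x) = (K *v x) \<bullet> (A *v (K *v x))" for x
    by (simp add: inner_matrix_vector[of x "conj_transpose K"] flip: matrix_vector_mul_assoc)
  ultimately show ?thesis
    using assms(1) by (simp add: pos_def_mat_iff conj_transpose_mult matrix_mul_assoc)
qed

section \<open>Complex orthogonality and the spectral theorem\<close>

definition cinner :: "complex^'n \<Rightarrow> complex^'n \<Rightarrow> complex" where
  "cinner x y = (\<Sum>i\<in>UNIV. cnj (x $ i) * y $ i)"

text \<open>The imaginary part of \<open>cinner x y\<close> is the real inner product of
  \<open>\<i> *s x\<close> with \<open>y\<close>. Complex orthogonality to \<open>k\<close> vectors
  thus becomes real orthogonality to \<open>2 k\<close> vectors.\<close>

lemma cinner_eq_0_iff: "cinner x y = 0 \<longleftrightarrow> x \<bullet> y = 0 \<and> (\<i> *s x) \<bullet> y = 0"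
proof -
  have "(\<i> *s x) \<bullet> y = Re (- \<i> * cinner x y)"
    by (simp add: inner_complex_vec cinner_def sum_distrib_left mult_ac sum_negf)
  moreover have "x \<bullet> y = Re (cinner x y)"
    by (simp add: inner_complex_vec cinner_def)
  ultimately show ?thesis by (auto simp: complex_eq_iff)
qed

lemma cinner_add: "cinner x (y + z) = cinner x y + cinner x z"
  by (simp add: cinner_def ring_distribs sum.distrib)

lemma cinner_scaleR: "cinner x (c *\<^sub>R y) = c *\<^sub>R cinner x y"
  by (simp add: cinner_def scaleR_sum_right)

lemma cinner_scaleR_left: "cinner (c *\<^sub>R x) y = c *\<^sub>R cinner x y"
  by (simp add: cinner_def scaleR_sum_right)

lemma cinner_commute: "cinner y x = cnj (cinner x y)"
  by (simp add: cinner_def mult.commute)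

lemma cinner_self: "cinner x x = complex_of_real ((norm x)\<^sup>2)"
  unfolding power2_norm_eq_inner
  by (simp add: cinner_def inner_vec_def mult.commute[of "cnj _"] complex_mult_cnj inner_complex_def power2_eq_square)

lemma cinner_matrix_vector: "cinner x (A *v y) = cinner (conj_transpose A *v x) y"
proof -
  have "cinner x (A *v y) = (\<Sum>i\<in>UNIV. \<Sum>j\<in>UNIV. cnj (x $ i) * (A $ i $ j * y $ j))"
    by (simp add: cinner_def matrix_vector_mult_def sum_distrib_left)
  also have "\<dots> = (\<Sum>j\<in>UNIV. \<Sum>i\<in>UNIV. cnj (x $ i) * (A $ i $ j * y $ j))"
    by (rule sum.swap)
  also have "\<dots> = cinner (conj_transpose A *v x) y"
    by (simp add: cinner_def matrix_vector_mult_def sum_distrib_left sum_distrib_right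
        conj_transpose_def mult_ac)
  finally show ?thesis .
qed

text \<open>The first-order condition at a maximum: for small \<open>t\<close> the linear term would
  dominate the quadratic one.\<close>

lemma quadratic_nonpos_imp_linear_coeff_0:
  fixes b c :: real
  assumes "\<And>t. 2 * t * b + t\<^sup>2 * c \<le> 0"
  shows "b = 0"
proof (rule ccontr)
  assume "b \<noteq> 0"
  \<comment> \<open>Since \<open>s\<close> exceeds the absolute value of \<open>c\<close>,
    \<open>2 * s + c\<close> is positive and \<open>t = b / s\<close> violates the
    assumption.\<close>
  define s where "s = 1 + \<bar>c\<bar>"
  have s: "s > 0" "c \<ge> - s" by (auto simp: s_def)
  have "2 * (b / s) * b + (b / s)\<^sup>2 * c = (b / s)\<^sup>2 * (2 * s + c)"
    using s by (simp add: field_simps power2_eq_square)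
  moreover have "(b / s)\<^sup>2 * (2 * s + c) > 0"
    using s \<open>b \<noteq> 0\<close> by simp
  ultimately show False
    using assms[of "b / s"] by linarith
qed

text \<open>The complement \<open>W\<close> of the given eigenvectors is invariant under
  \<open>A\<close>. A maximizer of the quadratic form over the unit sphere of \<open>W\<close> is an
  eigenvector, and its eigenvalue is the maximum.\<close>

lemma hermitian_eigenvector_in_complement:
  fixes A :: "complex^'n^'n" and v :: "nat \<Rightarrow> complex^'n"
  assumes herm: "conj_transpose A = A" and k: "k < CARD('n)"
    and ev: "\<And>i. i < k \<Longrightarrow> A *v v i = l i *\<^sub>R v i"
  obtains u \<mu> where "norm u = 1" "A *v u = \<mu> *\<^sub>R u" "\<And>i. i < k \<Longrightarrow> cinner (v i) u = 0"
proof -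
  define W where "W = {x. \<forall>i<k. cinner (v i) x = 0}"
  \<comment> \<open>\<open>W\<close> is the real orthogonal complement of \<open>B\<close>. At most
    \<open>2 k\<close> vectors cannot span a space of real dimension \<open>2 n\<close>, so
    \<open>W\<close> contains a nonzero vector.\<close>
  define B where "B = v ` {..<k} \<union> (\<lambda>i. \<i> *s v i) ` {..<k}"
  have "card B \<le> k + k"
    unfolding B_def by (intro order_trans[OF card_Un_le] add_mono order_trans[OF card_image_le]) auto
  moreover have "finite B" by (simp add: B_def)
  then have "dim B \<le> card B"
    by (simp add: dim_le_card')
  ultimately have "dim B < DIM(complex^'n)"
    using k by simp
  then obtain x where x: "x \<noteq> 0" "\<And>y. y \<in> span B \<Longrightarrow> orthogonal x y"
    using orthogonal_to_subspace_exists by blast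
  have "y \<bullet> x = 0" if "y \<in> B" for y
    using x(2)[OF span_base[OF that]] by (simp add: orthogonal_def inner_commute)
  moreover have "v i \<in> B" "\<i> *s v i \<in> B" if "i < k" for i
    using that by (auto simp: B_def)
  ultimately have "x \<in> W"
    unfolding W_def cinner_eq_0_iff by blast
  have W_add: "y + z \<in> W" if "y \<in> W" "z \<in> W" for y z
    using that by (simp add: W_def cinner_add)
  have W_scale: "c *\<^sub>R y \<in> W" if "y \<in> W" for y c
    using that by (simp add: W_def cinner_scaleR)
  have W_A: "A *v y \<in> W" if "y \<in> W" for y
    using that by (simp add: W_def cinner_matrix_vector herm ev cinner_scaleR_left)
  have "closed W"
    unfolding W_def cinner_def Collect_ball_eq
    by (intro closed_Collect_all closed_Collect_imp closed_Collect_eq continuous_intros open_Collect_const)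
  then have "compact (sphere 0 1 \<inter> W)" by (intro compact_Int_closed) auto
  moreover have "(1 / norm x) *\<^sub>R x \<in> sphere 0 1 \<inter> W"
    using x(1) \<open>x \<in> W\<close> by (auto intro: W_scale)
  then have "sphere 0 1 \<inter> W \<noteq> {}" by blast
  moreover have "continuous_on (sphere 0 1 \<inter> W) (\<lambda>y. y \<bullet> (A *v y))"
    by (intro continuous_intros linear_continuous_on matrix_vector_mul_bounded_linear)
  ultimately obtain u where u: "u \<in> sphere 0 1 \<inter> W"
    and max: "\<And>y. y \<in> sphere 0 1 \<inter> W \<Longrightarrow> y \<bullet> (A *v y) \<le> u \<bullet> (A *v u)"
    using continuous_attains_sup[of "sphere 0 1 \<inter> W" "\<lambda>y. y \<bullet> (A *v y)"] by blast
  define \<mu> where "\<mu> = u \<bullet> (A *v u)"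
  have le: "y \<bullet> (A *v y) \<le> \<mu> * (y \<bullet> y)" if "y \<in> W" for y
  proof (cases "y = 0")
    case False
    have "(1 / norm y) *\<^sub>R y \<in> sphere 0 1 \<inter> W"
      using False that by (auto intro: W_scale)
    from max[OF this] have "(y \<bullet> (A *v y)) / (norm y)\<^sup>2 \<le> \<mu>"
      by (simp add: \<mu>_def matrix_vector_scaleR_right power2_eq_square)
    then show ?thesis
      using False by (simp add: field_simps power2_norm_eq_inner)
  qed simp
  \<comment> \<open>The residual of the eigenvalue equation. Moving from \<open>u\<close> to
    \<open>u + t *\<^sub>R r\<close> stays in \<open>W\<close>, and the first-order coefficient of
    the resulting inequality is \<open>r \<bullet> r\<close>, which therefore vanishes.\<close>
  define r where "r = A *v u - \<mu> *\<^sub>R u"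
  have "r \<in> W"
    unfolding r_def using u W_add[OF W_A W_scale, of u u "- \<mu>"] by auto
  have uu: "u \<bullet> u = 1" using u by (simp add: norm_eq_1)
  have "r \<bullet> r = 0"
  proof (rule quadratic_nonpos_imp_linear_coeff_0)
    fix t :: real
    have sym: "u \<bullet> (A *v r) = r \<bullet> (A *v u)"
      using inner_matrix_vector[of u A r] herm by (simp add: inner_commute)
    have "(u + t *\<^sub>R r) \<bullet> (A *v (u + t *\<^sub>R r)) \<le> \<mu> * ((u + t *\<^sub>R r) \<bullet> (u + t *\<^sub>R r))"
      using u \<open>r \<in> W\<close> by (intro le W_add W_scale) auto
    then have "\<mu> + 2 * t * (r \<bullet> (A *v u)) + t\<^sup>2 * (r \<bullet> (A *v r)) \<le> \<mu> * (1 + 2 * t * (r \<bullet> u) + t\<^sup>2 * (r \<bullet> r))"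
      by (simp add: matrix_vector_right_distrib matrix_vector_scaleR_right inner_add_left inner_add_right
          sym uu \<mu>_def[symmetric] power2_eq_square inner_commute[of u r] algebra_simps)
    moreover have "r \<bullet> (A *v u) = r \<bullet> r + \<mu> * (r \<bullet> u)"
      using arg_cong[OF r_def, of "\<lambda>z. r \<bullet> z"] by (simp add: inner_diff_right)
    ultimately have "\<mu> + 2 * t * (r \<bullet> r + \<mu> * (r \<bullet> u)) + t\<^sup>2 * (r \<bullet> (A *v r))
        \<le> \<mu> * (1 + 2 * t * (r \<bullet> u) + t\<^sup>2 * (r \<bullet> r))"
      by simp
    then show "2 * t * (r \<bullet> r) + t\<^sup>2 * (r \<bullet> (A *v r) - \<mu> * (r \<bullet> r)) \<le> 0"
      by (simp add: algebra_simps)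
  qed
  then have "A *v u = \<mu> *\<^sub>R u" by (simp add: r_def)
  with u that show ?thesis by (auto simp: W_def)
qed

lemma hermitian_orthonormal_eigenvectors:
  fixes A :: "complex^'n^'n"
  assumes herm: "conj_transpose A = A" and "k \<le> CARD('n)"
  shows "\<exists>v l. \<forall>i<k. A *v v i = l i *\<^sub>R v i \<and> (\<forall>j<k. cinner (v i) (v j) = (if i = j then 1 else 0))"
  using assms(2)
proof (induction k)
  case (Suc k)
  then obtain v l where
    vl: "\<And>i. i < k \<Longrightarrow> A *v v i = l i *\<^sub>R v i"
      "\<And>i j. i < k \<Longrightarrow> j < k \<Longrightarrow> cinner (v i) (v j) = (if i = j then 1 else 0)"
    by (metis Suc_leD)
  have "k < CARD('n)" using Suc.prems by simp
  then obtain u \<mu> where u: "norm u = 1" "A *v u = \<mu> *\<^sub>R u" "\<And>i. i < k \<Longrightarrow> cinner (v i) u = 0"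
    using hermitian_eigenvector_in_complement[where v = v and l = l and k = k, OF herm] vl(1) by metis
  have u': "cinner u (v i) = 0" if "i < k" for i
    using u(3)[OF that] cinner_commute[of "v i" u] by simp
  show ?case
    by (rule exI[of _ "v(k := u)"], rule exI[of _ "l(k := \<mu>)"])
      (use vl u u' in \<open>auto simp: less_Suc_eq cinner_self\<close>)
qed simp

definition real_diag :: "('n \<Rightarrow> real) \<Rightarrow> complex^'n^'n" where
  "real_diag d = (\<chi> i j. if i = j then of_real (d i) else 0)"

text \<open>For unitary \<open>U\<close> this is the functional calculus: with \<open>U\<close>
  fixed, products and linear combinations act entrywise on the eigenvalues \<open>d\<close>.\<close>

definition diag_conj :: "complex^'n^'n \<Rightarrow> ('n \<Rightarrow> real) \<Rightarrow> complex^'n^'n" where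
  "diag_conj U d = U ** real_diag d ** conj_transpose U"

lemma hermitian_spectral:
  fixes A :: "complex^'n^'n"
  assumes herm: "conj_transpose A = A"
  obtains U d where "conj_transpose U ** U = mat 1" "A = diag_conj U d"
proof -
  obtain v l where
    vl: "\<And>i. i < CARD('n) \<Longrightarrow> A *v v i = l i *\<^sub>R v i"
      "\<And>i j. i < CARD('n) \<Longrightarrow> j < CARD('n) \<Longrightarrow> cinner (v i) (v j) = (if i = j then 1 else 0)"
    using hermitian_orthonormal_eigenvectors[OF herm order_refl] by metis
  \<comment> \<open>The eigenvectors are numbered by naturals; \<open>f\<close> transfers them to
    the index type of the matrix.\<close>
  obtain f :: "'n \<Rightarrow> nat" where f: "bij_betw f UNIV {..<CARD('n)}"
    using bij_betw_iff_card[of "UNIV::'n set" "{..<CARD('n)}"] by auto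
  have fi: "f i < CARD('n)" for i using f by (auto simp: bij_betw_def)
  have finj: "f i = f j \<longleftrightarrow> i = j" for i j using f by (auto simp: bij_betw_def inj_def)
  define U :: "complex^'n^'n" where "U = (\<chi> i j. v (f j) $ i)"
  define D :: "complex^'n^'n" where "D = (\<chi> i j. if i = j then of_real (l (f i)) else 0)"
  have "(conj_transpose U ** U) $ i $ j = cinner (v (f i)) (v (f j))" for i j
    by (simp add: conj_transpose_def matrix_matrix_mult_def U_def cinner_def)
  then have 1: "conj_transpose U ** U = mat 1"
    using vl(2)[OF fi fi] by (simp add: vec_eq_iff mat_def finj)
  have "(A ** U) $ i $ j = (A *v v (f j)) $ i" for i j
    by (simp add: matrix_matrix_mult_def U_def matrix_vector_mult_def)
  moreover have "(U ** D) $ i $ j = (l (f j) *\<^sub>R v (f j)) $ i" for i j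
    by (simp add: matrix_matrix_mult_def D_def U_def if_distrib[of "(*) _"] cong: if_cong)
       (simp add: scaleR_conv_of_real[symmetric] scaleR_complex.ctr complex_eq_iff mult.commute)
  ultimately have "A ** U = U ** D"
    using vl(1)[OF fi] by (simp add: vec_eq_iff)
  then have "A ** U ** conj_transpose U = U ** D ** conj_transpose U" by simp
  moreover have "U ** conj_transpose U = mat 1"
    using 1 matrix_left_right_inverse by blast
  ultimately have "A = U ** D ** conj_transpose U"
    by (metis matrix_mul_assoc matrix_mul_rid)
  with that[of U "\<lambda>i. l (f i)"] 1 show ?thesis
    unfolding diag_conj_def real_diag_def D_def by simp
qed

subsection \<open>Spectral calculus and square roots\<close>

lemma real_diag_mult: "real_diag d ** real_diag e = real_diag (\<lambda>i. d i * e i)"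
  by (simp add: real_diag_def matrix_matrix_mult_def vec_eq_iff
      if_distrib[of "\<lambda>c. c * _"] cong: if_cong)

lemma real_diag_mult_vec: "(real_diag d *v x) $ i = of_real (d i) * x $ i"
  by (simp add: real_diag_def matrix_vector_mult_def if_distrib[of "\<lambda>c. c * _"] cong: if_cong)

lemma conj_transpose_real_diag: "conj_transpose (real_diag d) = real_diag d"
  by (auto simp: real_diag_def conj_transpose_def vec_eq_iff)

lemma real_diag_1: "real_diag (\<lambda>i. 1) = mat 1"
  by (simp add: real_diag_def mat_def vec_eq_iff)

lemma unitary_commute:
  fixes U :: "complex^'n^'n"
  shows "conj_transpose U ** U = mat 1 \<Longrightarrow> U ** conj_transpose U = mat 1"
  using matrix_left_right_inverse by blast

lemma diag_conj_mult:
  fixes U :: "complex^'n^'n"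
  assumes "conj_transpose U ** U = mat 1"
  shows "diag_conj U d ** diag_conj U e = diag_conj U (\<lambda>i. d i * e i)"
proof -
  have "diag_conj U d ** diag_conj U e
      = U ** real_diag d ** (conj_transpose U ** U) ** real_diag e ** conj_transpose U"
    by (simp add: diag_conj_def matrix_mul_assoc)
  also have "\<dots> = U ** (real_diag d ** real_diag e) ** conj_transpose U"
    unfolding assms by (simp add: matrix_mul_assoc)
  finally show ?thesis by (simp add: real_diag_mult diag_conj_def)
qed

lemma conj_transpose_diag_conj: "conj_transpose (diag_conj U d) = diag_conj U d"
  by (simp add: diag_conj_def conj_transpose_mult conj_transpose_real_diag matrix_mul_assoc)

lemma diag_conj_1:
  fixes U :: "complex^'n^'n"
  shows "conj_transpose U ** U = mat 1 \<Longrightarrow> diag_conj U (\<lambda>i. 1) = mat 1"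
  by (simp add: diag_conj_def real_diag_1 unitary_commute)

lemma rtr_diag_conj:
  fixes U :: "complex^'n^'n"
  assumes "conj_transpose U ** U = mat 1"
  shows "rtr (diag_conj U d) = sum d UNIV"
proof -
  have "trace (diag_conj U d) = trace (real_diag d)"
    unfolding diag_conj_def by (subst trace_cyclic3) (simp add: assms)
  then show ?thesis by (simp add: trace_def real_diag_def)
qed

lemma inner_diag_conj:
  "x \<bullet> (diag_conj U d *v x) = (\<Sum>i\<in>UNIV. d i * (cmod ((conj_transpose U *v x) $ i))\<^sup>2)"
proof -
  let ?y = "conj_transpose U *v x"
  have "x \<bullet> (diag_conj U d *v x) = ?y \<bullet> (real_diag d *v ?y)"
    by (simp add: diag_conj_def inner_matrix_vector[of x U] flip: matrix_vector_mul_assoc)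
  also have "\<dots> = (\<Sum>i\<in>UNIV. d i * (?y $ i \<bullet> ?y $ i))"
    by (simp add: inner_vec_def real_diag_mult_vec flip: scaleR_conv_of_real)
  finally show ?thesis by (simp only: power2_norm_eq_inner)
qed

lemma norm_unitary_coordinates:
  fixes U :: "complex^'n^'n"
  assumes "conj_transpose U ** U = mat 1"
  shows "(norm x)\<^sup>2 = (\<Sum>i\<in>UNIV. (cmod ((conj_transpose U *v x) $ i))\<^sup>2)"
  using inner_diag_conj[of x U "\<lambda>i. 1"] by (simp add: diag_conj_1[OF assms] power2_norm_eq_inner)

section \<open>Order intervals \<open>a I \<le> X \<le> b I\<close> of Hermitian matrices\<close>

definition spectral_box :: "real \<Rightarrow> real \<Rightarrow> (complex^'n^'n) set" where
  "spectral_box a b = {X. conj_transpose X = X \<and>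
     (\<forall>x. a * (norm x)\<^sup>2 \<le> x \<bullet> (X *v x) \<and> x \<bullet> (X *v x) \<le> b * (norm x)\<^sup>2)}"

text \<open>Column \<open>i\<close> of \<open>U\<close> serves all diagonals at once, so it reads
  the eigenvalue \<open>d i\<close> off the matrix.\<close>

lemma unitary_column:
  fixes U :: "complex^'n^'n"
  assumes "conj_transpose U ** U = mat 1"
  obtains x where "norm x = 1" "\<And>d. diag_conj U d *v x = d i *\<^sub>R x"
proof
  define x where "x = U *v axis i 1"
  have *: "conj_transpose U *v x = axis i 1"
    by (simp add: x_def matrix_vector_mul_assoc assms)
  have "(norm x)\<^sup>2 = 1"
    unfolding norm_unitary_coordinates[OF assms] *
    by (simp add: axis_def if_distrib[of cmod] if_distrib[of "\<lambda>x. x\<^sup>2"] cong: if_cong)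
  then show "norm x = 1"
    using norm_ge_zero[of x] by (simp only: power2_eq_1_iff) linarith
  show "diag_conj U d *v x = d i *\<^sub>R x" for d
  proof -
    have "real_diag d *v axis i 1 = d i *\<^sub>R axis i (1::complex)"
      by (auto simp: vec_eq_iff real_diag_mult_vec axis_def of_real_def)
    then show ?thesis
      by (simp add: diag_conj_def * flip: matrix_vector_mul_assoc)
        (simp add: matrix_vector_scaleR_right x_def)
  qed
qed

lemma inner_unitary_column:
  fixes U :: "complex^'n^'n"
  assumes "conj_transpose U ** U = mat 1"
  obtains x where "norm x = 1" "\<And>d. x \<bullet> (diag_conj U d *v x) = d i"
proof -
  obtain x where x: "norm x = 1" "\<And>d. diag_conj U d *v x = d i *\<^sub>R x"
    using unitary_column[OF assms, where i = i] by blast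
  from x(1) have "x \<bullet> x = 1" by (simp add: norm_eq_1)
  with x(1) show ?thesis by (intro that[of x]) (simp_all add: x(2))
qed

text \<open>Testing the form on the columns of \<open>U\<close> bounds each eigenvalue; conversely,
  in the coordinates given by \<open>U\<close> the form is a sum that can be compared term by
  term.\<close>

lemma diag_conj_in_spectral_box_iff:
  fixes U :: "complex^'n^'n"
  assumes "conj_transpose U ** U = mat 1"
  shows "diag_conj U d \<in> spectral_box a b \<longleftrightarrow> (\<forall>i. a \<le> d i \<and> d i \<le> b)"
proof
  assume L: "diag_conj U d \<in> spectral_box a b"
  show "\<forall>i. a \<le> d i \<and> d i \<le> b"
  proof
    fix i
    obtain x where "norm x = 1" "x \<bullet> (diag_conj U d *v x) = d i"
      using inner_unitary_column[OF assms] by metis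
    with L show "a \<le> d i \<and> d i \<le> b"
      unfolding spectral_box_def by (metis (lifting) mem_Collect_eq mult.right_neutral power_one)
  qed
next
  assume "\<forall>i. a \<le> d i \<and> d i \<le> b"
  then show "diag_conj U d \<in> spectral_box a b"
    by (auto simp: spectral_box_def conj_transpose_diag_conj inner_diag_conj sum_distrib_left
        norm_unitary_coordinates[OF assms] intro!: sum_mono mult_right_mono)
qed

lemma spectral_box_imp_pos_def:
  assumes "0 < a" "X \<in> spectral_box a b"
  shows "pos_def_mat X"
proof -
  have "0 < x \<bullet> (X *v x)" if "x \<noteq> 0" for x
  proof -
    have "0 < a * (norm x)\<^sup>2" using assms(1) that by simp
    also have "\<dots> \<le> x \<bullet> (X *v x)" using assms(2) by (simp add: spectral_box_def)
    finally show ?thesis .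
  qed
  with assms(2) show ?thesis by (simp add: pos_def_mat_iff spectral_box_def)
qed

lemma pos_def_spectral:
  fixes A :: "complex^'n^'n"
  assumes "pos_def_mat A"
  obtains U d where "conj_transpose U ** U = mat 1" "A = diag_conj U d" "\<And>i. 0 < d i"
proof -
  obtain U d where Ud: "conj_transpose U ** U = mat 1" "A = diag_conj U d"
    using hermitian_spectral[OF pos_def_mat_hermitian[OF assms]] by metis
  have "0 < d i" for i
  proof -
    obtain x where x: "norm x = 1" "x \<bullet> (diag_conj U d *v x) = d i"
      using inner_unitary_column[OF Ud(1)] by metis
    then have "x \<noteq> 0" by auto
    with x assms Ud(2) show ?thesis by (metis pos_def_mat_iff)
  qed
  with Ud that show ?thesis by blast
qed

lemma pos_def_in_spectral_box:
  fixes A :: "complex^'n^'n"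
  assumes "pos_def_mat A"
  obtains a b where "0 < a" "A \<in> spectral_box a b"
proof -
  obtain U d where Ud: "conj_transpose U ** U = mat 1" "A = diag_conj U d" "\<And>i. 0 < d i"
    using pos_def_spectral[OF assms] by metis
  show ?thesis
  proof
    show "0 < Min (range d)" using Ud(3) by (subst Min_gr_iff) auto
    show "A \<in> spectral_box (Min (range d)) (Max (range d))"
      unfolding Ud(2) diag_conj_in_spectral_box_iff[OF Ud(1)] by simp
  qed
qed

lemma pos_def_diag_conj:
  fixes U :: "complex^'n^'n"
  assumes "conj_transpose U ** U = mat 1" "\<And>i. 0 < d i"
  shows "pos_def_mat (diag_conj U d)"
proof -
  have "0 < Min (range d)" using assms(2) by (subst Min_gr_iff) auto
  moreover have "diag_conj U d \<in> spectral_box (Min (range d)) (Max (range d))"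
    unfolding diag_conj_in_spectral_box_iff[OF assms(1)] by simp
  ultimately show ?thesis by (rule spectral_box_imp_pos_def)
qed

section \<open>Inverses and square roots of positive definite matrices\<close>

lemma pos_def_inverse:
  assumes "pos_def_mat A"
  obtains B where "pos_def_mat B" "A ** B = mat 1" "B ** A = mat 1"
proof -
  obtain U d where Ud: "conj_transpose U ** U = mat 1" "A = diag_conj U d" "\<And>i. 0 < d i"
    using pos_def_spectral[OF assms] by metis
  have "d i * (1 / d i) = 1" "1 / d i * d i = 1" for i using Ud(3)[of i] by auto
  then show ?thesis
    using that[of "diag_conj U (\<lambda>i. 1 / d i)"] Ud
    by (simp add: diag_conj_mult diag_conj_1 pos_def_diag_conj)
qed

text \<open>The difference \<open>D = B - C\<close> satisfies \<open>B D + D C = 0\<close>.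
  Multiplying by \<open>D\<close> and taking traces makes the nonnegative numbers
  \<open>tr D B D\<close> and \<open>tr D C D\<close> sum to zero, which forces
  \<open>D = 0\<close>.\<close>

lemma pos_def_sqrt_unique:
  assumes "pos_def_mat B" "pos_def_mat C" "B ** B = C ** C"
  shows "B = C"
proof -
  define D where "D = B - C"
  have herm: "conj_transpose D = D"
    using assms by (simp add: D_def conj_transpose_diff pos_def_mat_hermitian)
  have "B ** D + D ** C = 0"
    using assms(3) by (simp add: D_def matrix_ring_simps)
  then have "D ** (B ** D + D ** C) = 0"
    by (simp add: matrix_matrix_mult_def vec_eq_iff)
  then have "D ** B ** D + D ** D ** C = 0"
    by (simp add: matrix_ring_simps)
  then have "rtr (D ** B ** D + D ** D ** C) = 0"
    by (simp add: trace_def)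
  moreover have "trace (D ** D ** C) = trace (D ** C ** D)"
    using trace_cyclic3[of D C D] by simp
  ultimately have "rtr (D ** B ** D) + rtr (D ** C ** D) = 0"
    by (simp add: trace_add)
  moreover have "0 \<le> rtr (D ** B ** D)" "0 \<le> rtr (D ** C ** D)"
    using rtr_sandwich_nonneg[of _ D] assms herm by auto
  ultimately have "rtr (D ** B ** D) = 0" by simp
  then have "D = 0"
    using rtr_sandwich_eq_0[OF assms(1), of D] herm by simp
  then show ?thesis by (simp add: D_def)
qed

lemma pd_sqrt_eqI: "pos_def_mat B \<Longrightarrow> B ** B = A \<Longrightarrow> pd_sqrt A = B"
  unfolding pd_sqrt_def by (rule the_equality) (auto intro: pos_def_sqrt_unique)

lemma pd_sqrt_diag_conj:
  fixes U :: "complex^'n^'n"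
  assumes "conj_transpose U ** U = mat 1" "\<And>i. 0 < d i"
  shows "pd_sqrt (diag_conj U d) = diag_conj U (\<lambda>i. sqrt (d i))"
  using assms by (intro pd_sqrt_eqI) (auto simp: diag_conj_mult pos_def_diag_conj less_imp_le)

lemma
  assumes "pos_def_mat A"
  shows pos_def_pd_sqrt: "pos_def_mat (pd_sqrt A)"
    and pd_sqrt_mult_self: "pd_sqrt A ** pd_sqrt A = A"
proof -
  obtain U d where Ud: "conj_transpose U ** U = mat 1" "A = diag_conj U d" "\<And>i. 0 < d i"
    using pos_def_spectral[OF assms] by metis
  show "pos_def_mat (pd_sqrt A)"
    using Ud(3) by (simp add: Ud(2) pd_sqrt_diag_conj[OF Ud(1,3)] pos_def_diag_conj[OF Ud(1)])
  show "pd_sqrt A ** pd_sqrt A = A"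
    using Ud(3) by (simp add: Ud(2) pd_sqrt_diag_conj[OF Ud(1,3)] diag_conj_mult[OF Ud(1)] less_imp_le)
qed

lemma pd_sqrt_in_spectral_box:
  assumes "0 < a" "A \<in> spectral_box a b"
  shows "pd_sqrt A \<in> spectral_box (sqrt a) (sqrt b)"
proof -
  obtain U d where Ud: "conj_transpose U ** U = mat 1" "A = diag_conj U d" "\<And>i. 0 < d i"
    using pos_def_spectral[OF spectral_box_imp_pos_def[OF assms]] by metis
  show ?thesis
    using assms(2) Ud by (simp add: pd_sqrt_diag_conj diag_conj_in_spectral_box_iff)
qed

text \<open>The squared norm of \<open>X *v x\<close> is the form of \<open>X ** X\<close> at
  \<open>x\<close>, and the eigenvalues of \<open>X ** X\<close> lie between \<open>0\<close> and
  \<open>b * b\<close>.\<close>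

lemma spectral_box_norm_le:
  assumes "0 \<le> a" "X \<in> spectral_box a b"
  shows "norm (X *v x) \<le> b * norm x"
proof -
  have herm: "conj_transpose X = X" using assms(2) by (simp add: spectral_box_def)
  obtain U d where Ud: "conj_transpose U ** U = mat 1" "X = diag_conj U d"
    using hermitian_spectral[OF herm] by metis
  have d: "0 \<le> d i" "d i \<le> b" for i
    using assms Ud by (auto simp: diag_conj_in_spectral_box_iff intro: order_trans)
  then have "0 \<le> b" using order_trans by blast
  have "diag_conj U (\<lambda>i. d i * d i) \<in> spectral_box 0 (b * b)"
    using d \<open>0 \<le> b\<close> by (auto simp: diag_conj_in_spectral_box_iff[OF Ud(1)] intro!: mult_mono)
  moreover have "(norm (X *v x))\<^sup>2 = x \<bullet> ((X ** X) *v x)"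
    by (simp add: inner_matrix_vector[of x X] herm power2_norm_eq_inner flip: matrix_vector_mul_assoc)
  ultimately have "(norm (X *v x))\<^sup>2 \<le> (b * norm x)\<^sup>2"
    by (simp add: spectral_box_def Ud(2) diag_conj_mult[OF Ud(1)] power2_eq_square mult_ac)
  then show ?thesis
    using \<open>0 \<le> b\<close> by (simp add: power2_le_iff_abs_le)
qed

section \<open>Compactness of order intervals and continuity of the square root\<close>

lemma continuous_on_matrix_mult [continuous_intros]:
  fixes f g :: "'a::topological_space \<Rightarrow> complex^'n^'n"
  assumes "continuous_on S f" "continuous_on S g"
  shows "continuous_on S (\<lambda>x. f x ** g x)"
  unfolding matrix_matrix_mult_def
  by (intro continuous_on_vec_lambda continuous_on_sum continuous_on_mult continuous_on_component assms)

lemma convex_spectral_box: "convex (spectral_box a b)"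
proof (rule convexI)
  fix X Y :: "complex^'n^'n" and u v :: real
  assume X: "X \<in> spectral_box a b" and Y: "Y \<in> spectral_box a b"
    and uv: "0 \<le> u" "0 \<le> v" "u + v = 1"
  have "a * (norm x)\<^sup>2 \<le> u * (x \<bullet> (X *v x)) + v * (x \<bullet> (Y *v x)) \<and>
      u * (x \<bullet> (X *v x)) + v * (x \<bullet> (Y *v x)) \<le> b * (norm x)\<^sup>2" for x
    using X Y uv convex_bound_le[of "x \<bullet> (X *v x)" "b * (norm x)\<^sup>2" "x \<bullet> (Y *v x)" u v]
      convex_bound_le[of "- (x \<bullet> (X *v x))" "- (a * (norm x)\<^sup>2)" "- (x \<bullet> (Y *v x))" u v]
    by (simp add: spectral_box_def)
  then show "u *\<^sub>R X + v *\<^sub>R Y \<in> spectral_box a b"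
    using X Y by (simp add: spectral_box_def conj_transpose_add conj_transpose_scaleR
        matrix_vector_mult_add_rdistrib matrix_vector_scaleR_left inner_add_right)
qed

text \<open>The norm of the matrix type is the Frobenius norm, hence computable from
  eigenvalues.\<close>

lemma norm_matrix_eq_rtr: "(norm X)\<^sup>2 = rtr (conj_transpose X ** X)" for X :: "complex^'n^'n"
proof -
  have "(norm X)\<^sup>2 = (\<Sum>i\<in>UNIV. \<Sum>j\<in>UNIV. Re (cnj (X $ i $ j) * X $ i $ j))"
    unfolding power2_norm_eq_inner by (simp add: inner_vec_def inner_complex_def)
  also have "\<dots> = (\<Sum>j\<in>UNIV. \<Sum>i\<in>UNIV. Re (cnj (X $ i $ j) * X $ i $ j))"
    by (rule sum.swap)
  finally show ?thesis
    by (simp add: trace_def matrix_matrix_mult_def conj_transpose_def)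
qed

text \<open>The squared Frobenius norm is the sum of the squared eigenvalues, each at most
  \<open>b * b\<close>; closedness holds because the defining conditions are closed.\<close>

lemma compact_spectral_box:
  assumes "0 \<le> a"
  shows "compact (spectral_box a b :: (complex^'n^'n) set)"
  unfolding compact_eq_bounded_closed
proof
  have "norm X \<le> sqrt (real CARD('n) * b\<^sup>2)" if "X \<in> spectral_box a b" for X :: "complex^'n^'n"
  proof -
    have herm: "conj_transpose X = X" using that by (simp add: spectral_box_def)
    obtain U d where Ud: "conj_transpose U ** U = mat 1" "X = diag_conj U d"
      using hermitian_spectral[OF herm] by metis
    have d: "0 \<le> d i" "d i \<le> b" for i
      using assms that Ud by (auto simp: diag_conj_in_spectral_box_iff intro: order_trans)
    have "(norm X)\<^sup>2 = (\<Sum>i\<in>UNIV. d i * d i)"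
      by (simp add: norm_matrix_eq_rtr herm, simp add: Ud(2) diag_conj_mult[OF Ud(1)] rtr_diag_conj[OF Ud(1)])
    also have "\<dots> \<le> (\<Sum>i\<in>(UNIV::'n set). b * b)"
      using d by (intro sum_mono mult_mono) (auto intro: order_trans)
    finally show ?thesis
      by (simp add: real_le_rsqrt power2_eq_square)
  qed
  then show "bounded (spectral_box a b :: (complex^'n^'n) set)"
    unfolding bounded_iff by blast
  have ct: "continuous_on UNIV (conj_transpose :: complex^'n^'n \<Rightarrow> _)"
    unfolding conj_transpose_def
    by (intro continuous_on_vec_lambda continuous_on_cnj continuous_on_component continuous_on_id)
  have q: "continuous_on UNIV (\<lambda>X::complex^'n^'n. x \<bullet> (X *v x))" for x
    unfolding matrix_vector_mult_def
    by (intro continuous_on_inner continuous_on_const continuous_on_vec_lambda continuous_on_sum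
        continuous_on_mult continuous_on_component continuous_on_id)
  have "closed {X :: complex^'n^'n. conj_transpose X = X}"
    by (rule closed_Collect_eq[OF ct continuous_on_id])
  moreover have "closed {X :: complex^'n^'n. a * (norm x)\<^sup>2 \<le> x \<bullet> (X *v x)}" for x
    by (rule closed_Collect_le[OF continuous_on_const q])
  moreover have "closed {X :: complex^'n^'n. x \<bullet> (X *v x) \<le> b * (norm x)\<^sup>2}" for x
    by (rule closed_Collect_le[OF q continuous_on_const])
  ultimately show "closed (spectral_box a b :: (complex^'n^'n) set)"
    unfolding spectral_box_def by (intro closed_Collect_conj closed_Collect_all)
qed

text \<open>Squaring is continuous and injective on a compact order interval of positive definite
  matrices, so its inverse is continuous on the image.\<close>

lemma continuous_on_pd_sqrt:
  assumes "0 < a"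
  shows "continuous_on (spectral_box a b) pd_sqrt"
proof -
  let ?B = "spectral_box (sqrt a) (sqrt b)"
  have "continuous_on ((\<lambda>Y. Y ** Y) ` ?B) pd_sqrt"
  proof (rule continuous_on_inv)
    show "compact ?B" using assms by (intro compact_spectral_box) auto
    show "\<forall>Y\<in>?B. pd_sqrt (Y ** Y) = Y"
      using assms spectral_box_imp_pos_def[of "sqrt a" _ "sqrt b"] by (auto intro!: pd_sqrt_eqI)
  qed (intro continuous_intros)
  moreover have "spectral_box a b \<subseteq> (\<lambda>Y. Y ** Y) ` ?B"
  proof
    fix X :: "complex^'n^'n"
    assume X: "X \<in> spectral_box a b"
    show "X \<in> (\<lambda>Y. Y ** Y) ` ?B"
    proof (rule image_eqI)
      show "X = pd_sqrt X ** pd_sqrt X"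
        by (rule pd_sqrt_mult_self[OF spectral_box_imp_pos_def[OF assms X], symmetric])
      show "pd_sqrt X \<in> ?B"
        by (rule pd_sqrt_in_spectral_box[OF assms X])
    qed
  qed
  ultimately show ?thesis by (rule continuous_on_subset)
qed

subsection \<open>Schatten norms and trace inequalities\<close>

text \<open>Constants embedded as polynomials, so that multiplicativity of the determinant can be
  applied to the characteristic matrix.\<close>

definition const_mat :: "complex^'n^'n \<Rightarrow> complex poly^'n^'n" where
  "const_mat M = (\<chi> i j. [:M $ i $ j:])"

lemma const_mat_mult: "const_mat (A ** B) = const_mat A ** const_mat B"
  by (simp add: const_mat_def matrix_matrix_mult_def vec_eq_iff mult.commute flip: sum_to_poly)

lemma const_mat_1: "const_mat (mat 1) = mat 1"
  by (simp add: const_mat_def mat_def vec_eq_iff one_pCons)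

lemma charpoly_eq_det: "charpoly M = det (mat [:0, 1:] - const_mat M)"
  unfolding charpoly_def by (rule arg_cong[of _ _ det]) (simp add: vec_eq_iff mat_def const_mat_def)

text \<open>The scalar matrix of the indeterminate commutes with \<open>U\<close>, so the unitary
  factors come out of the determinant and cancel, leaving a diagonal matrix.\<close>

lemma charpoly_diag_conj:
  fixes U :: "complex^'n^'n"
  assumes "conj_transpose U ** U = mat 1"
  shows "charpoly (diag_conj U d) = (\<Prod>i\<in>UNIV. [:- of_real (d i), 1:])"
proof -
  let ?X = "mat [:0, 1:] :: complex poly^'n^'n"
  let ?U = "const_mat U" and ?V = "const_mat (conj_transpose U)" and ?D = "const_mat (real_diag d)"
  have UV: "?U ** ?V = mat 1"
    by (simp add: unitary_commute[OF assms] const_mat_1 flip: const_mat_mult)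
  have "?U ** ?X = ?X ** ?U"
    by (simp add: matrix_matrix_mult_def mat_def vec_eq_iff if_distrib[of "\<lambda>c. c * _"]
        if_distrib[of "(*) _"] mult.commute cong: if_cong)
  then have "?U ** ?X ** ?V = ?X"
    using UV by (metis matrix_mul_assoc matrix_mul_rid)
  then have "?X - const_mat (diag_conj U d) = ?U ** (?X - ?D) ** ?V"
    by (simp add: matrix_diff_ldistrib matrix_diff_rdistrib diag_conj_def const_mat_mult)
  then have "charpoly (diag_conj U d) = det ?U * det (?X - ?D) * det ?V"
    by (simp add: charpoly_eq_det det_mul)
  also have "\<dots> = det (?U ** ?V) * det (?X - ?D)"
    by (simp add: det_mul)
  also have "det (?X - ?D) = (\<Prod>i\<in>UNIV. (?X - ?D) $ i $ i)"
    by (rule det_diagonal) (simp add: mat_def const_mat_def real_diag_def)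
  finally show ?thesis
    unfolding UV det_I by (simp add: mat_def const_mat_def real_diag_def)
qed

text \<open>\<open>X\<^sup>* X\<close> has eigenvalues \<open>d i * d i\<close>, whose square roots
  are \<open>d i\<close> by positivity. The root multiset is computed one linear factor at a
  time.\<close>

lemma sum_mset_singular_values_diag_conj:
  fixes U :: "complex^'n^'n"
  assumes U: "conj_transpose U ** U = mat 1" and d: "\<And>i. 0 < d i"
  shows "(\<Sum>s\<in>#singular_values (diag_conj U d). f s) = (\<Sum>i\<in>UNIV. f (d i))"
proof -
  have "(\<Sum>s\<in>#image_mset (\<lambda>\<mu>. sqrt (Re \<mu>)) (proots (\<Prod>i\<in>I. [:- complex_of_real (d i * d i), 1:])). f s)
      = (\<Sum>i\<in>I. f (d i))" if "finite I" for I :: "'n set"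
    using that by (induction I) (simp_all add: proots_mult d less_imp_le del: mult_pCons_left)
  then show ?thesis
    by (simp add: singular_values_def conj_transpose_diag_conj diag_conj_mult[OF U] charpoly_diag_conj[OF U])
qed

lemma schatten_norm_1_pos_def:
  assumes "pos_def_mat X"
  shows "schatten_norm 1 X = rtr X"
proof -
  obtain U d where Ud: "conj_transpose U ** U = mat 1" "X = diag_conj U d" "\<And>i. 0 < d i"
    using pos_def_spectral[OF assms] by metis
  have "schatten_norm 1 X = (\<Sum>i\<in>UNIV. d i powr 1) powr 1"
    by (simp add: schatten_norm_def Ud(2) sum_mset_singular_values_diag_conj[OF Ud(1,3)])
  also have "\<dots> = (\<Sum>i\<in>UNIV. d i)"
    using Ud(3) by (simp add: less_imp_le sum_nonneg)
  finally show ?thesis by (simp add: Ud(2) rtr_diag_conj[OF Ud(1)])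
qed

lemma schatten_norm_2_pos_def:
  assumes "pos_def_mat X"
  shows "schatten_norm 2 X = sqrt (rtr (X ** X))"
proof -
  obtain U d where Ud: "conj_transpose U ** U = mat 1" "X = diag_conj U d" "\<And>i. 0 < d i"
    using pos_def_spectral[OF assms] by metis
  have "schatten_norm 2 X = (\<Sum>i\<in>UNIV. d i powr 2) powr (1 / 2)"
    by (simp add: schatten_norm_def Ud(2) sum_mset_singular_values_diag_conj[OF Ud(1,3)])
  also have "\<dots> = sqrt (\<Sum>i\<in>UNIV. d i * d i)"
    using Ud(3) by (simp add: powr_half_sqrt sum_nonneg less_imp_le power2_eq_square)
  finally show ?thesis by (simp add: Ud(2) diag_conj_mult[OF Ud(1)] rtr_diag_conj[OF Ud(1)])
qed

lemma schatten_norm_inf: "schatten_norm \<infinity> X = onorm ((*v) X)"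
  by (simp add: schatten_norm_def)

text \<open>Operator monotonicity of the square root, since the hypothesis says
  \<open>P\<^sup>2 \<le> Q\<^sup>2\<close>. An eigenvector of \<open>Q - P\<close> with a negative
  eigenvalue would be stretched strictly more by \<open>P\<close> than by \<open>Q\<close>.\<close>

lemma pos_def_le_of_norm_le:
  assumes P: "pos_def_mat P" and Q: "pos_def_mat Q"
    and le: "\<And>x. norm (P *v x) \<le> norm (Q *v x)"
  shows "x \<bullet> (P *v x) \<le> x \<bullet> (Q *v x)"
proof -
  have "conj_transpose (Q - P) = Q - P"
    using P Q by (simp add: conj_transpose_diff pos_def_mat_hermitian)
  then obtain U d where Ud: "conj_transpose U ** U = mat 1" "Q - P = diag_conj U d"
    using hermitian_spectral by metis
  have "0 \<le> d i" for i
  proof (rule ccontr)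
    assume neg: "\<not> 0 \<le> d i"
    obtain u where u: "norm u = 1" "diag_conj U d *v u = d i *\<^sub>R u"
      using unitary_column[OF Ud(1), where i = i] by metis
    have uu: "u \<bullet> u = 1" using u(1) by (simp add: norm_eq_1)
    have Pu: "P *v u = Q *v u - d i *\<^sub>R u"
    proof -
      have "(Q - P) *v u = d i *\<^sub>R u" using u(2) Ud(2) by simp
      then show ?thesis by (simp add: matrix_vector_mult_diff_rdistrib algebra_simps)
    qed
    have "(norm (P *v u))\<^sup>2 = (norm (Q *v u))\<^sup>2 - 2 * d i * (u \<bullet> (Q *v u)) + d i * d i"
      unfolding Pu power2_norm_eq_inner
      by (simp add: inner_diff_left inner_diff_right uu inner_commute[of u "Q *v u"] algebra_simps)
    moreover have "0 \<le> - 2 * d i * (u \<bullet> (Q *v u))"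
      by (rule mult_nonneg_nonneg) (use neg pos_def_mat_nonneg[OF Q, of u] in simp_all)
    moreover have "0 < d i * d i" using neg by (simp add: mult_neg_neg)
    moreover have "(norm (P *v u))\<^sup>2 \<le> (norm (Q *v u))\<^sup>2"
      by (rule power_mono[OF le]) simp
    ultimately show False by linarith
  qed
  then have "0 \<le> x \<bullet> ((Q - P) *v x)"
    unfolding Ud(2) inner_diag_conj by (auto intro!: sum_nonneg)
  then show ?thesis
    by (simp add: matrix_vector_mult_diff_rdistrib inner_diff_right)
qed

section \<open>Trace inequalities for two matrices\<close>

lemma mult_cancel_inverse: "A ** B = mat 1 \<Longrightarrow> X ** A ** B = X" for A :: "complex^'n^'n"
  by (metis matrix_mul_assoc matrix_mul_rid)

lemma mult_assoc_subst: "A ** B = C \<Longrightarrow> X ** A ** B = X ** C" for A :: "complex^'n^'n"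
  by (metis matrix_mul_assoc)

text \<open>A special case of the Bebiano--Lemos--Providencia inequality. It follows by adding
  \<open>tr K\<^sup>* (R g R) K \<ge> 0\<close> with \<open>K = R g - g R\<close> and \<open>tr Y\<^sup>* G Y \<ge> 0\<close>
  with \<open>Y = P\<^sup>2 - g R P\<close>, where \<open>g\<close> is the inverse of \<open>G\<close>.\<close>
lemma rtr_cube_mult_le:
  fixes P R G :: "complex^'n^'n"
  assumes P: "pos_def_mat P" and R: "pos_def_mat R" and G: "pos_def_mat G"
    and eq: "R ** R = G ** P ** P ** G"
  shows "rtr (P ** P ** P ** R) \<le> rtr (P ** P ** P ** P ** G)"
proof -
  obtain g where g: "pos_def_mat g" "G ** g = mat 1" "g ** G = mat 1"
    using pos_def_inverse[OF G] by metis
  note herm = P[THEN pos_def_mat_hermitian] R[THEN pos_def_mat_hermitian]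
    G[THEN pos_def_mat_hermitian] g(1)[THEN pos_def_mat_hermitian]
  note sub = g(2,3) g(2,3)[THEN mult_cancel_inverse] eq eq[THEN mult_assoc_subst] matrix_mul_assoc
  obtain r where r: "R ** r = mat 1" "r ** R = mat 1"
    using pos_def_inverse[OF R] by metis
  have J: "pos_def_mat (R ** g ** R)"
    using pos_def_mat_congruence[OF g(1) r(2)] herm by simp
  define K where "K = R ** g - g ** R"
  have "conj_transpose K ** (R ** g ** R) ** K
      = P ** P ** G ** P ** P - P ** P ** R ** g ** R - R ** g ** R ** P ** P + R ** g ** R ** g ** R ** g ** R"
    by (simp add: K_def conj_transpose_diff conj_transpose_mult herm matrix_diff_ldistrib
        matrix_diff_rdistrib sub)
  moreover have "trace (R ** g ** R ** P ** P) = trace (P ** P ** R ** g ** R)"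
    using trace_mul_sym[of "R ** g ** R" "P ** P"] by (simp add: matrix_mul_assoc)
  \<comment> \<open>Cyclicity brings the two outer factors \<open>R\<close> together; their product
    is \<open>G ** P ** P ** G\<close>, and both \<open>G\<close> cancel against a neighbouring
    \<open>g\<close>.\<close>
  moreover have "trace (R ** g ** R ** g ** R ** g ** R) = trace (P ** P ** R ** g ** R)"
    using trace_mul_sym[of "R ** g ** R ** g ** R ** g" R] trace_mul_sym[of G "P ** P ** R ** g ** R ** g"]
    by (simp add: sub)
  moreover have GP: "trace (P ** P ** G ** P ** P) = trace (P ** P ** P ** P ** G)"
    using trace_mul_sym[of "P ** P ** G" "P ** P"] by (simp add: matrix_mul_assoc)
  ultimately have "rtr (conj_transpose K ** (R ** g ** R) ** K)
      = rtr (P ** P ** P ** P ** G) - rtr (P ** P ** R ** g ** R)"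
    by (simp add: trace_add trace_sub)
  then have 1: "rtr (P ** P ** R ** g ** R) \<le> rtr (P ** P ** P ** P ** G)"
    using rtr_sandwich_nonneg[OF J, of K] by simp
  define Y where "Y = P ** P - g ** R ** P"
  have "conj_transpose Y ** G ** Y
      = P ** P ** G ** P ** P - P ** P ** R ** P - P ** R ** P ** P + P ** R ** g ** R ** P"
    by (simp add: Y_def conj_transpose_diff conj_transpose_mult herm matrix_diff_ldistrib
        matrix_diff_rdistrib sub)
  moreover have "trace (P ** P ** R ** P) = trace (P ** P ** P ** R)"
    using trace_mul_sym[of "P ** P ** R" P] by (simp add: matrix_mul_assoc)
  moreover have "trace (P ** R ** P ** P) = trace (P ** P ** P ** R)"
    using trace_mul_sym[of "P ** R" "P ** P"] by (simp add: matrix_mul_assoc)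
  moreover have "trace (P ** R ** g ** R ** P) = trace (P ** P ** R ** g ** R)"
    using trace_mul_sym[of "P ** R ** g ** R" P] by (simp add: matrix_mul_assoc)
  ultimately have "rtr (conj_transpose Y ** G ** Y)
      = rtr (P ** P ** P ** P ** G) - 2 * rtr (P ** P ** P ** R) + rtr (P ** P ** R ** g ** R)"
    using GP by (simp add: trace_add trace_sub)
  with 1 show ?thesis
    using rtr_sandwich_nonneg[OF G, of Y] by simp
qed

text \<open>Expand \<open>tr K\<^sup>* K \<ge> 0\<close> for the commutator \<open>K\<close> of
  \<open>A\<close> and \<open>B\<close>.\<close>

lemma rtr_alternating_le:
  assumes "conj_transpose A = A" "conj_transpose B = B"
  shows "rtr (A ** B ** A ** B) \<le> rtr (A ** A ** B ** B)"
proof -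
  define K where "K = A ** B - B ** A"
  have "conj_transpose K ** mat 1 ** K
      = B ** A ** A ** B - B ** A ** B ** A - A ** B ** A ** B + A ** B ** B ** A"
    by (simp add: K_def conj_transpose_diff conj_transpose_mult assms matrix_diff_ldistrib
        matrix_diff_rdistrib matrix_mul_assoc)
  moreover have "trace (B ** A ** A ** B) = trace (A ** A ** B ** B)"
    using trace_mul_sym[of B "A ** A ** B"] by (simp add: matrix_mul_assoc)
  moreover have "trace (B ** A ** B ** A) = trace (A ** B ** A ** B)"
    using trace_mul_sym[of B "A ** B ** A"] by (simp add: matrix_mul_assoc)
  moreover have "trace (A ** B ** B ** A) = trace (A ** A ** B ** B)"
    using trace_mul_sym[of "A ** B ** B" A] by (simp add: matrix_mul_assoc)
  ultimately have "rtr (conj_transpose K ** mat 1 ** K)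
      = 2 * rtr (A ** A ** B ** B) - 2 * rtr (A ** B ** A ** B)"
    by (simp add: trace_add trace_sub)
  then show ?thesis
    using rtr_sandwich_nonneg[OF pos_def_mat_1, of K] by simp
qed

text \<open>The trace of the square is a part independent of \<open>M\<close> plus a combination of
  \<open>tr A M\<close>, \<open>tr B M\<close> and \<open>tr M\<^sup>2\<close> with nonnegative
  coefficients.\<close>

lemma rtr_square_two_point_mean_le:
  fixes A B M N :: "complex^'n^'n"
  assumes "0 \<le> a" "0 \<le> b" "rtr (A ** M) \<le> rtr (A ** N)" "rtr (B ** M) \<le> rtr (B ** N)"
    "rtr (M ** M) \<le> rtr (N ** N)"
  shows "rtr ((a\<^sup>2 *\<^sub>R A + b\<^sup>2 *\<^sub>R B + (a * b) *\<^sub>R M) ** (a\<^sup>2 *\<^sub>R A + b\<^sup>2 *\<^sub>R B + (a * b) *\<^sub>R M))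
    \<le> rtr ((a\<^sup>2 *\<^sub>R A + b\<^sup>2 *\<^sub>R B + (a * b) *\<^sub>R N) ** (a\<^sup>2 *\<^sub>R A + b\<^sup>2 *\<^sub>R B + (a * b) *\<^sub>R N))"
proof -
  have *: "rtr ((a\<^sup>2 *\<^sub>R A + b\<^sup>2 *\<^sub>R B + (a * b) *\<^sub>R M) ** (a\<^sup>2 *\<^sub>R A + b\<^sup>2 *\<^sub>R B + (a * b) *\<^sub>R M))
      = rtr ((a\<^sup>2 *\<^sub>R A + b\<^sup>2 *\<^sub>R B) ** (a\<^sup>2 *\<^sub>R A + b\<^sup>2 *\<^sub>R B))
        + 2 * (a * b) * (a\<^sup>2 * rtr (A ** M) + b\<^sup>2 * rtr (B ** M)) + (a * b)\<^sup>2 * rtr (M ** M)" for M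
    by (simp add: matrix_ring_simps trace_add trace_scaleR trace_mul_sym[of M A] trace_mul_sym[of M B] algebra_simps power2_eq_square)
  show ?thesis
    unfolding * using assms by (intro add_mono mult_left_mono order_refl) auto
qed

text \<open>The two sides are the squared power mean and the squared Wasserstein mean after
  expansion. They differ only in the cross terms \<open>P R + R P\<close> and
  \<open>A G + G A\<close>, which are compared against \<open>A\<close>, against \<open>B\<close>
  and by their squares.\<close>

lemma rtr_square_two_point_le:
  fixes P R G :: "complex^'n^'n"
  assumes P: "pos_def_mat P" and R: "pos_def_mat R" and G: "pos_def_mat G"
    and eq: "G ** (P ** P) ** G = R ** R" and ab: "0 \<le> a" "0 \<le> b"
  defines "A \<equiv> P ** P" and "B \<equiv> R ** R"
  shows "rtr ((a\<^sup>2 *\<^sub>R A + b\<^sup>2 *\<^sub>R B + (a * b) *\<^sub>R (P ** R + R ** P))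
            ** (a\<^sup>2 *\<^sub>R A + b\<^sup>2 *\<^sub>R B + (a * b) *\<^sub>R (P ** R + R ** P)))
    \<le> rtr ((a\<^sup>2 *\<^sub>R A + b\<^sup>2 *\<^sub>R B + (a * b) *\<^sub>R (A ** G + G ** A))
         ** (a\<^sup>2 *\<^sub>R A + b\<^sup>2 *\<^sub>R B + (a * b) *\<^sub>R (A ** G + G ** A)))"
proof (rule rtr_square_two_point_mean_le[OF ab])
  obtain g where g: "pos_def_mat g" "G ** g = mat 1" "g ** G = mat 1"
    using pos_def_inverse[OF G] by metis
  \<comment> \<open>Exchanging \<open>A\<close> with \<open>B\<close> and \<open>G\<close> with its
    inverse \<open>g\<close> preserves the cross term, so the estimate against \<open>A\<close> also
    gives the one against \<open>B\<close>.\<close>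
  have AG: "A ** G = g ** B"
    by (simp add: A_def B_def matrix_mul_assoc g flip: eq)
  have GA: "G ** A = B ** g"
    by (simp add: A_def B_def matrix_mul_assoc mult_cancel_inverse[OF g(2)] flip: eq)
  have eq': "P ** P = g ** R ** R ** g"
  proof -
    have "g ** (R ** R) ** g = P ** P"
      by (simp add: matrix_mul_assoc g mult_cancel_inverse[OF g(2)] flip: eq)
    then show ?thesis by (simp add: matrix_mul_assoc)
  qed
  have sym1: "trace (X ** (Y ** X)) = trace (X ** (X ** Y))" for X Y :: "complex^'n^'n"
    using trace_mul_sym[of "X ** Y" X] by (simp add: matrix_mul_assoc)
  show "rtr (A ** (P ** R + R ** P)) \<le> rtr (A ** (A ** G + G ** A))"
  proof -
    have "trace (A ** (R ** P)) = trace (P ** P ** P ** R)"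
      using trace_mul_sym[of "P ** P ** R" P] by (simp add: A_def matrix_mul_assoc)
    then have "rtr (A ** (P ** R + R ** P)) = 2 * rtr (P ** P ** P ** R)"
      by (simp add: matrix_ring_simps trace_add) (simp add: A_def matrix_mul_assoc)
    moreover have "rtr (A ** (A ** G + G ** A)) = 2 * rtr (P ** P ** P ** P ** G)"
      by (simp add: matrix_add_ldistrib trace_add sym1) (simp add: A_def matrix_mul_assoc)
    ultimately show ?thesis
      using rtr_cube_mult_le[OF P R G] eq by (simp add: matrix_mul_assoc)
  qed
  show "rtr (B ** (P ** R + R ** P)) \<le> rtr (B ** (A ** G + G ** A))"
  proof -
    have "trace (B ** (P ** R)) = trace (R ** R ** R ** P)"
      using trace_mul_sym[of "R ** R ** P" R] by (simp add: B_def matrix_mul_assoc)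
    then have "rtr (B ** (P ** R + R ** P)) = 2 * rtr (R ** R ** R ** P)"
      by (simp add: matrix_ring_simps trace_add) (simp add: B_def matrix_mul_assoc)
    moreover have "rtr (B ** (A ** G + G ** A)) = 2 * rtr (R ** R ** R ** R ** g)"
      unfolding AG GA by (simp add: matrix_add_ldistrib trace_add sym1) (simp add: B_def matrix_mul_assoc)
    ultimately show ?thesis
      using rtr_cube_mult_le[OF R P g(1) eq'] by simp
  qed
  show "rtr ((P ** R + R ** P) ** (P ** R + R ** P)) \<le> rtr ((A ** G + G ** A) ** (A ** G + G ** A))"
  proof -
    have *: "rtr ((X ** Y + Y ** X) ** (X ** Y + Y ** X))
        = 2 * rtr (X ** Y ** X ** Y) + 2 * rtr (X ** X ** Y ** Y)" for X Y :: "complex^'n^'n"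
      using trace_mul_sym[of Y "X ** Y ** X"] trace_mul_sym[of Y "X ** X ** Y"] trace_mul_sym[of "X ** Y ** Y" X]
      by (simp add: matrix_ring_simps trace_add)
    have hA: "conj_transpose A = A"
      using P by (simp add: A_def conj_transpose_mult pos_def_mat_hermitian)
    have 1: "rtr (P ** R ** P ** R) \<le> rtr (P ** P ** R ** R)"
      by (rule rtr_alternating_le) (simp_all add: P R pos_def_mat_hermitian)
    have 2: "rtr (A ** G ** A ** G) \<le> rtr (A ** A ** G ** G)"
      by (rule rtr_alternating_le) (simp_all add: hA G pos_def_mat_hermitian)
    \<comment> \<open>This identity joins the two estimates into
      \<open>tr P R P R \<le> tr P P R R = tr A G A G \<le> tr A A G G\<close>.\<close>
    have "A ** G ** A ** G = A ** (G ** (P ** P) ** G)" by (simp add: A_def matrix_mul_assoc)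
    then have "A ** G ** A ** G = P ** P ** R ** R"
      unfolding eq by (simp add: A_def matrix_mul_assoc)
    with 1 2 show ?thesis unfolding * by simp
  qed
qed

subsection \<open>The Wasserstein mean\<close>

declare One_nat_def [simp del]

text \<open>With \<open>Y\<close> the square root of \<open>X\<close>, the square of
  \<open>Y G Y\<close> is \<open>Y A Y\<close>, so the square root in the distance is
  \<open>Y G Y\<close>, of trace \<open>tr X G\<close>.\<close>

lemma bures_wasserstein_dist_square:
  fixes X A G :: "complex^'n^'n"
  assumes X: "pos_def_mat X" and A: "pos_def_mat A" and G: "pos_def_mat G"
    and GXG: "G ** X ** G = A"
  shows "(bures_wasserstein_dist X A)\<^sup>2 = rtr X + rtr A - 2 * rtr (X ** G)"
proof -
  define Y where "Y = pd_sqrt X"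
  have Y: "pos_def_mat Y" "Y ** Y = X"
    using X by (simp_all add: Y_def pos_def_pd_sqrt pd_sqrt_mult_self)
  obtain y where y: "y ** Y = mat 1"
    using pos_def_inverse[OF Y(1)] by metis
  have "pos_def_mat (Y ** G ** Y)"
    using pos_def_mat_congruence[OF G y] by (simp add: pos_def_mat_hermitian[OF Y(1)])
  moreover have "(Y ** G ** Y) ** (Y ** G ** Y) = Y ** A ** Y"
    by (simp add: matrix_mul_assoc flip: GXG Y(2))
  ultimately have "pd_sqrt (Y ** A ** Y) = Y ** G ** Y"
    by (rule pd_sqrt_eqI)
  moreover have "trace (Y ** G ** Y) = trace (X ** G)"
    using trace_mul_sym[of "Y ** G" Y] by (simp add: matrix_mul_assoc Y(2))
  ultimately have dist: "bures_wasserstein_dist X A = sqrt (rtr X + rtr A - 2 * rtr (X ** G))"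
    by (simp add: bures_wasserstein_dist_def Y_def trace_add)
  \<comment> \<open>The expansion of \<open>tr K\<^sup>* X K\<close> shows that the radicand is
    nonnegative, so squaring undoes \<open>sqrt\<close>.\<close>
  define K where "K = mat 1 - G"
  have "conj_transpose K ** X ** K = X - X ** G - G ** X + A"
    by (simp add: K_def conj_transpose_diff pos_def_mat_hermitian[OF G] matrix_diff_ldistrib
        matrix_diff_rdistrib GXG)
  then have "rtr (conj_transpose K ** X ** K) = rtr X + rtr A - 2 * rtr (X ** G)"
    by (simp add: trace_add trace_sub trace_mul_sym[of G X])
  with rtr_sandwich_nonneg[OF X, of K] show ?thesis
    by (simp add: dist)
qed

text \<open>The witness is the geometric mean of the inverse of \<open>X\<close> and
  \<open>A\<close>, known as the optimal transport map between centered Gaussians with covariances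
  \<open>X\<close> and \<open>A\<close>. The last property links it to the fixed-point equation of
  the mean.\<close>

lemma ex_transport_map:
  fixes X A :: "complex^'n^'n"
  assumes X: "pos_def_mat X" and A: "pos_def_mat A"
  obtains G where "pos_def_mat G" "G ** X ** G = A"
    "pd_sqrt X ** G ** pd_sqrt X = pd_sqrt (pd_sqrt X ** A ** pd_sqrt X)"
proof -
  define Y where "Y = pd_sqrt X"
  have Y: "pos_def_mat Y" "Y ** Y = X"
    using X by (simp_all add: Y_def pos_def_pd_sqrt pd_sqrt_mult_self)
  obtain y where y: "pos_def_mat y" "Y ** y = mat 1" "y ** Y = mat 1"
    using pos_def_inverse[OF Y(1)] by metis
  note herm = pos_def_mat_hermitian[OF Y(1)] pos_def_mat_hermitian[OF y(1)]
  note cancel = y(2,3) y(2,3)[THEN mult_cancel_inverse] matrix_mul_assoc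
  define Z where "Z = pd_sqrt (Y ** A ** Y)"
  have "pos_def_mat (Y ** A ** Y)"
    using pos_def_mat_congruence[OF A y(3)] herm by simp
  then have Z: "pos_def_mat Z" "Z ** Z = Y ** A ** Y"
    by (simp_all add: Z_def pos_def_pd_sqrt pd_sqrt_mult_self)
  show ?thesis
  proof
    show "pos_def_mat (y ** Z ** y)"
      using pos_def_mat_congruence[OF Z(1) y(2)] herm by simp
    have "(y ** Z ** y) ** X ** (y ** Z ** y) = y ** (Z ** Z) ** y"
      by (simp add: cancel flip: Y(2))
    also have "\<dots> = A"
      unfolding Z(2) by (simp add: cancel)
    finally show "(y ** Z ** y) ** X ** (y ** Z ** y) = A" .
    show "pd_sqrt X ** (y ** Z ** y) ** pd_sqrt X = pd_sqrt (pd_sqrt X ** A ** pd_sqrt X)"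
      unfolding Y_def[symmetric] Z_def[symmetric] by (simp add: cancel)
  qed
qed

text \<open>Both sides of \<open>eq\<close> stand for the same target \<open>A\<close>. The gap is
  \<open>tr K\<^sup>* g K\<close>, where \<open>g\<close> is the inverse of \<open>G\<close> and
  \<open>K\<close> is \<open>G - H\<close> times the square root of \<open>X\<close>; it vanishes
  only for \<open>K = 0\<close>.\<close>

lemma transport_cost_gap:
  fixes X \<Omega> G H :: "complex^'n^'n"
  assumes X: "pos_def_mat X" and G: "pos_def_mat G" and H: "pos_def_mat H"
    and eq: "H ** X ** H = G ** \<Omega> ** G"
  shows "2 * rtr (X ** H) \<le> rtr (X ** G) + rtr (\<Omega> ** G)"
    and "2 * rtr (X ** H) = rtr (X ** G) + rtr (\<Omega> ** G) \<Longrightarrow> H = G"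
proof -
  obtain g where g: "pos_def_mat g" "G ** g = mat 1" "g ** G = mat 1"
    using pos_def_inverse[OF G] by metis
  note cancel = g(2,3) g(2,3)[THEN mult_cancel_inverse] matrix_mul_assoc
  define Y where "Y = pd_sqrt X"
  have Y: "pos_def_mat Y" "Y ** Y = X"
    using X by (simp_all add: Y_def pos_def_pd_sqrt pd_sqrt_mult_self)
  note herm = pos_def_mat_hermitian[OF Y(1)] pos_def_mat_hermitian[OF G] pos_def_mat_hermitian[OF H]
  define K where "K = (G - H) ** Y"
  have "conj_transpose K ** g ** K = Y ** ((G - H) ** g ** (G - H)) ** Y"
    by (simp only: K_def conj_transpose_mult conj_transpose_diff herm matrix_mul_assoc)
  also have "(G - H) ** g ** (G - H) = G - H - H + H ** g ** H"
    by (simp add: matrix_diff_ldistrib matrix_diff_rdistrib cancel)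
  finally have "conj_transpose K ** g ** K = Y ** (G - H - H + H ** g ** H) ** Y" .
  then have "trace (conj_transpose K ** g ** K) = trace (X ** (G - H - H + H ** g ** H))"
    using trace_mul_sym[of "Y ** (G - H - H + H ** g ** H)" Y]
    by (simp only: matrix_mul_assoc Y(2))
  \<comment> \<open>The only place where \<open>\<Omega>\<close> enters: \<open>H X H\<close>
    appears cyclically and is replaced by \<open>G \<Omega> G\<close>.\<close>
  moreover have "trace (X ** H ** g ** H) = trace (\<Omega> ** G)"
  proof -
    have "trace (X ** H ** g ** H) = trace (H ** X ** H ** g)"
      using trace_mul_sym[of "X ** H ** g" H] by (simp add: matrix_mul_assoc)
    also have "\<dots> = trace (G ** \<Omega>)"
      unfolding eq by (simp add: cancel)
    also have "\<dots> = trace (\<Omega> ** G)" by (rule trace_mul_sym)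
    finally show ?thesis .
  qed
  ultimately have "trace (conj_transpose K ** g ** K)
      = trace (X ** G) - trace (X ** H) - trace (X ** H) + trace (\<Omega> ** G)"
    by (simp only: matrix_diff_ldistrib matrix_add_ldistrib trace_add trace_sub matrix_mul_assoc)
  then have *: "rtr (conj_transpose K ** g ** K) = rtr (X ** G) + rtr (\<Omega> ** G) - 2 * rtr (X ** H)"
    by simp
  show "2 * rtr (X ** H) \<le> rtr (X ** G) + rtr (\<Omega> ** G)"
    using rtr_sandwich_nonneg[OF g(1), of K] unfolding * by simp
  assume "2 * rtr (X ** H) = rtr (X ** G) + rtr (\<Omega> ** G)"
  then have "K = 0"
    using * by (intro rtr_sandwich_eq_0[OF g(1)]) simp
  obtain y where y: "Y ** y = mat 1"
    using pos_def_inverse[OF Y(1)] by metis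
  have "G - H = K ** y"
    by (simp add: K_def mult_cancel_inverse[OF y])
  also have "\<dots> = 0"
    unfolding \<open>K = 0\<close> by (simp add: matrix_matrix_mult_def vec_eq_iff)
  finally show "H = G" by simp
qed

section \<open>Barycenters, and the cases \<open>p = 1\<close> and
  \<open>p = \<infinity>\<close>\<close>

lemma sum_matrix_vector: "sum f J *v x = (\<Sum>j\<in>J. f j *v x)"
  by (induction J rule: infinite_finite_induct) (auto simp: matrix_vector_mult_add_rdistrib)

text \<open>An optimality certificate for \<open>\<Omega>\<close>: its transport maps to the given
  matrices average to the identity. This is the fixed-point equation with the square root of
  \<open>\<Omega>\<close> cancelled on both sides.\<close>

locale barycenter =
  fixes m :: nat and w :: "nat \<Rightarrow> real" and A G :: "nat \<Rightarrow> complex^'n^'n" and \<Omega> :: "complex^'n^'n"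
  assumes A: "\<And>j. j \<in> {1..m} \<Longrightarrow> pos_def_mat (A j)"
    and w: "\<And>j. j \<in> {1..m} \<Longrightarrow> 0 \<le> w j" "(\<Sum>j=1..m. w j) = 1"
    and \<Omega>: "pos_def_mat \<Omega>"
    and G: "\<And>j. j \<in> {1..m} \<Longrightarrow> pos_def_mat (G j)"
    and transport: "\<And>j. j \<in> {1..m} \<Longrightarrow> G j ** \<Omega> ** G j = A j"
    and sum_G: "(\<Sum>j=1..m. w j *\<^sub>R G j) = mat 1"
begin

lemma rtr_eq_sum: "rtr X = (\<Sum>j=1..m. w j * rtr (X ** G j))"
proof -
  have "rtr (X ** (\<Sum>j=1..m. w j *\<^sub>R G j)) = (\<Sum>j=1..m. w j * rtr (X ** G j))"
    by (simp add: matrix_sum_ldistrib trace_sum matrix_scaleR_right trace_scaleR)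
  then show ?thesis by (simp add: sum_G)
qed

text \<open>The excess of the objective at \<open>X\<close> over its value at
  \<open>\<Omega>\<close> is a weighted sum of the transport gaps, so it is nonnegative and vanishes
  only at \<open>\<Omega>\<close>.\<close>

lemma wasserstein_mean_eq: "wasserstein_mean m w A = \<Omega>"
proof -
  define \<phi> where "\<phi> = (\<lambda>X. \<Sum>j=1..m. w j * (bures_wasserstein_dist X (A j))\<^sup>2)"
  define K where "K = (\<Sum>j=1..m. w j * rtr (A j))"
  have \<phi>: "\<phi> X = rtr X + K - 2 * (\<Sum>j=1..m. w j * rtr (X ** H j))"
    if X: "pos_def_mat X" and H: "\<And>j. j \<in> {1..m} \<Longrightarrow> pos_def_mat (H j) \<and> H j ** X ** H j = A j" for X H
  proof -
    have "\<phi> X = (\<Sum>j=1..m. w j * (rtr X + rtr (A j) - 2 * rtr (X ** H j)))"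
      unfolding \<phi>_def using A X H by (intro sum.cong) (simp_all add: bures_wasserstein_dist_square)
    also have "\<dots> = (\<Sum>j=1..m. w j) * rtr X + K - 2 * (\<Sum>j=1..m. w j * rtr (X ** H j))"
      by (simp add: K_def sum_distrib_left sum_distrib_right ring_distribs sum.distrib sum_subtractf mult_ac)
    finally show ?thesis by (simp add: w)
  qed
  have main: "\<phi> \<Omega> \<le> \<phi> X \<and> (\<phi> X = \<phi> \<Omega> \<longrightarrow> X = \<Omega>)" if X: "pos_def_mat X" for X
  proof -
    have "\<forall>j. \<exists>H. j \<in> {1..m} \<longrightarrow> pos_def_mat H \<and> H ** X ** H = A j"
      using ex_transport_map[OF X A] by metis
    then obtain H where H: "\<And>j. j \<in> {1..m} \<Longrightarrow> pos_def_mat (H j) \<and> H j ** X ** H j = A j"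
      by metis
    define t where "t j = rtr (X ** G j) + rtr (\<Omega> ** G j) - 2 * rtr (X ** H j)" for j
    have t: "0 \<le> t j \<and> (t j = 0 \<longrightarrow> H j = G j)" if "j \<in> {1..m}" for j
      using transport_cost_gap[of X "G j" "H j" \<Omega>] H[OF that] G[OF that] transport[OF that] X
      by (auto simp: t_def)
    \<comment> \<open>The traces of \<open>X\<close> and \<open>\<Omega>\<close> are spread over the
      indices by means of \<open>sum_G\<close>.\<close>
    have "\<phi> X - \<phi> \<Omega> = (\<Sum>j=1..m. w j * t j)"
      using \<phi>[OF X H] \<phi>[OF \<Omega>, of G] G transport rtr_eq_sum[of X] rtr_eq_sum[of \<Omega>]
      by (simp add: t_def ring_distribs sum.distrib sum_subtractf sum_distrib_left mult_ac)
    moreover have nonneg: "0 \<le> w j * t j" if "j \<in> {1..m}" for j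
      using t[OF that] w(1)[OF that] by simp
    moreover have "X = \<Omega>" if "(\<Sum>j=1..m. w j * t j) = 0"
    proof -
      have zero: "\<forall>j\<in>{1..m}. w j * t j = 0"
        using that nonneg by (subst (asm) sum_nonneg_eq_0_iff) auto
      \<comment> \<open>Weights may vanish, but not all of them. One index with nonzero weight
        suffices, because its map \<open>G j\<close> is invertible.\<close>
      obtain j where j: "j \<in> {1..m}" "w j \<noteq> 0"
        using w(2) by (metis sum.neutral zero_neq_one)
      then have "H j = G j"
        using zero t[OF j(1)] by auto
      then have eq: "G j ** X ** G j = G j ** \<Omega> ** G j"
        using H[OF j(1)] transport[OF j(1)] by simp
      obtain g where g: "G j ** g = mat 1" "g ** G j = mat 1"
        using pos_def_inverse[OF G[OF j(1)]] by metis
      have "g ** (G j ** X ** G j) ** g = g ** (G j ** \<Omega> ** G j) ** g"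
        by (simp only: eq)
      then show "X = \<Omega>"
        by (simp add: matrix_mul_assoc g mult_cancel_inverse[OF g(1)])
    qed
    ultimately show ?thesis
      using sum_nonneg[of "{1..m}" "\<lambda>j. w j * t j"] by force
  qed
  show ?thesis
    unfolding wasserstein_mean_def \<phi>_def[symmetric]
    by (rule the_equality) (use main \<Omega> in \<open>auto simp: is_arg_min_linorder intro: antisym\<close>)
qed

lemma pos_def_power_mean_root: "pos_def_mat (\<Sum>j=1..m. w j *\<^sub>R pd_sqrt (A j))"
proof -
  let ?S = "\<Sum>j=1..m. w j *\<^sub>R pd_sqrt (A j)"
  have "conj_transpose ?S = (\<Sum>j=1..m. w j *\<^sub>R conj_transpose (pd_sqrt (A j)))"
    by (simp add: conj_transpose_def vec_eq_iff)
  also have "\<dots> = ?S"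
    using A by (intro sum.cong) (auto simp: pos_def_mat_hermitian pos_def_pd_sqrt)
  finally have "conj_transpose ?S = ?S" .
  moreover have "0 < x \<bullet> (?S *v x)" if "x \<noteq> 0" for x
  proof -
    have pos: "0 < x \<bullet> (pd_sqrt (A j) *v x)" if "j \<in> {1..m}" for j
      using pos_def_pd_sqrt[OF A[OF that]] \<open>x \<noteq> 0\<close> by (simp add: pos_def_mat_iff)
    obtain j where j: "j \<in> {1..m}" "w j \<noteq> 0"
      using w(2) by (metis sum.neutral zero_neq_one)
    have "0 < (\<Sum>j=1..m. w j * (x \<bullet> (pd_sqrt (A j) *v x)))"
      using j w(1) pos by (intro sum_pos2[of _ j]) (auto simp: less_le intro!: mult_nonneg_nonneg)
    then show ?thesis
      by (simp add: sum_matrix_vector inner_sum_right matrix_vector_scaleR_left)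
  qed
  ultimately show ?thesis by (simp add: pos_def_mat_iff)
qed

lemma pos_def_power_mean: "pos_def_mat (power_mean_half m w A)"
proof -
  let ?S = "\<Sum>j=1..m. w j *\<^sub>R pd_sqrt (A j)"
  note S = pos_def_power_mean_root
  obtain y where y: "y ** ?S = mat 1"
    using pos_def_inverse[OF S] by metis
  show ?thesis
    using pos_def_mat_congruence[OF pos_def_mat_1 y]
    by (simp add: power_mean_half_def Let_def pos_def_mat_hermitian[OF S])
qed

text \<open>Each summand inequality is \<open>tr K\<^sup>* G\<^sub>j K \<ge> 0\<close> for
  \<open>K = S - g P\<close>, with \<open>g\<close> the inverse of \<open>G\<^sub>j\<close>. After
  averaging, the left side is \<open>2 tr S\<^sup>2\<close> and the right side is
  \<open>tr S\<^sup>2 + tr \<Omega>\<close>.\<close>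

lemma rtr_power_mean_le: "rtr (power_mean_half m w A) \<le> rtr \<Omega>"
proof -
  define S where "S = (\<Sum>j=1..m. w j *\<^sub>R pd_sqrt (A j))"
  have S: "conj_transpose S = S"
    unfolding S_def by (rule pos_def_mat_hermitian[OF pos_def_power_mean_root])
  have step: "2 * rtr (S ** pd_sqrt (A j)) \<le> rtr (S ** S ** G j) + rtr (\<Omega> ** G j)"
    if j: "j \<in> {1..m}" for j
  proof -
    define P where "P = pd_sqrt (A j)"
    have P: "conj_transpose P = P" "P ** P = G j ** \<Omega> ** G j"
      unfolding P_def using A[OF j] transport[OF j]
      by (simp_all add: pos_def_mat_hermitian pos_def_pd_sqrt pd_sqrt_mult_self)
    obtain g where g: "pos_def_mat g" "G j ** g = mat 1" "g ** G j = mat 1"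
      using pos_def_inverse[OF G[OF j]] by metis
    note cancel = g(2,3) g(2,3)[THEN mult_cancel_inverse] matrix_mul_assoc
    define K where "K = S - g ** P"
    have "conj_transpose K ** G j ** K = S ** G j ** S - S ** P - P ** S + P ** g ** P"
      by (simp add: K_def conj_transpose_diff conj_transpose_mult S P(1) pos_def_mat_hermitian[OF g(1)]
          matrix_diff_ldistrib matrix_diff_rdistrib cancel)
    moreover have "trace (P ** g ** P) = trace (\<Omega> ** G j)"
    proof -
      have "trace (P ** g ** P) = trace (P ** P ** g)"
        using trace_mul_sym[of "P ** g" P] by (simp add: matrix_mul_assoc)
      also have "\<dots> = trace (G j ** \<Omega>)"
        unfolding P(2) by (simp add: cancel)
      also have "\<dots> = trace (\<Omega> ** G j)" by (rule trace_mul_sym)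
      finally show ?thesis .
    qed
    moreover have "trace (S ** G j ** S) = trace (S ** S ** G j)"
      using trace_mul_sym[of "S ** G j" S] by (simp add: matrix_mul_assoc)
    ultimately have "rtr (conj_transpose K ** G j ** K)
        = rtr (S ** S ** G j) + rtr (\<Omega> ** G j) - 2 * rtr (S ** P)"
      by (simp add: trace_add trace_sub trace_mul_sym[of P S])
    then show ?thesis
      using rtr_sandwich_nonneg[OF G[OF j], of K] unfolding P_def by simp
  qed
  have "rtr (S ** S) = (\<Sum>j=1..m. w j * rtr (S ** pd_sqrt (A j)))"
    by (subst (2) S_def) (simp add: matrix_sum_ldistrib trace_sum matrix_scaleR_right trace_scaleR)
  then have "2 * rtr (S ** S) = (\<Sum>j=1..m. w j * (2 * rtr (S ** pd_sqrt (A j))))"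
    by (simp add: sum_distrib_left mult_ac)
  also have "\<dots> \<le> (\<Sum>j=1..m. w j * (rtr (S ** S ** G j) + rtr (\<Omega> ** G j)))"
    using step w(1) by (intro sum_mono mult_left_mono) auto
  also have "\<dots> = rtr (S ** S) + rtr \<Omega>"
    unfolding rtr_eq_sum[of "S ** S"] rtr_eq_sum[of \<Omega>] by (simp add: distrib_left sum.distrib)
  finally show ?thesis
    by (simp add: power_mean_half_def Let_def flip: S_def)
qed

lemma onorm_power_mean_le: "onorm ((*v) (power_mean_half m w A)) \<le> onorm ((*v) \<Omega>)"
proof -
  define S where "S = (\<Sum>j=1..m. w j *\<^sub>R pd_sqrt (A j))"
  define \<mu> where "\<mu> = onorm ((*v) \<Omega>)"
  have \<mu>: "norm (\<Omega> *v x) \<le> \<mu> * norm x" for x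
    unfolding \<mu>_def by (rule onorm) simp
  have "0 \<le> \<mu>"
    unfolding \<mu>_def by (rule onorm_pos_le) simp
  \<comment> \<open>Strict positivity of \<open>\<mu>\<close> makes
    \<open>sqrt \<mu> *\<^sub>R G j\<close> positive definite, as the comparison of square roots
    requires.\<close>
  have "\<mu> \<noteq> 0"
  proof
    assume "\<mu> = 0"
    obtain x :: "complex^'n" where "x \<noteq> 0"
      using zero_neq_one by metis
    moreover have "\<Omega> *v x = 0" using \<mu>[of x] \<open>\<mu> = 0\<close> by simp
    ultimately show False using \<Omega> by (auto simp: pos_def_mat_iff)
  qed
  with \<open>0 \<le> \<mu>\<close> have "0 < \<mu>" by simp
  have le: "x \<bullet> (pd_sqrt (A j) *v x) \<le> sqrt \<mu> * (x \<bullet> (G j *v x))" if j: "j \<in> {1..m}" for j x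
  proof -
    have "pos_def_mat (sqrt \<mu> *\<^sub>R G j)"
      using G[OF j] \<open>0 < \<mu>\<close>
      by (simp add: pos_def_mat_iff conj_transpose_scaleR matrix_vector_scaleR_left)
    moreover have "norm (pd_sqrt (A j) *v y) \<le> norm ((sqrt \<mu> *\<^sub>R G j) *v y)" for y
    proof (rule power2_le_imp_le)
      let ?P = "pd_sqrt (A j)" and ?z = "G j *v y"
      have hP: "conj_transpose ?P = ?P"
        by (intro pos_def_mat_hermitian pos_def_pd_sqrt A j)
      have PP: "?P ** ?P = G j ** \<Omega> ** G j"
        using pd_sqrt_mult_self[OF A[OF j]] transport[OF j] by simp
      have "(norm (?P *v y))\<^sup>2 = y \<bullet> ((?P ** ?P) *v y)"
        by (simp add: inner_matrix_vector[of y ?P] hP power2_norm_eq_inner flip: matrix_vector_mul_assoc)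
      also have "\<dots> = ?z \<bullet> (\<Omega> *v ?z)"
        unfolding PP
        by (simp add: inner_matrix_vector[of y "G j"] pos_def_mat_hermitian[OF G[OF j]]
            flip: matrix_vector_mul_assoc)
      also have "\<dots> \<le> norm ?z * norm (\<Omega> *v ?z)"
        by (rule norm_cauchy_schwarz)
      also have "\<dots> \<le> norm ?z * (\<mu> * norm ?z)"
        by (intro mult_left_mono \<mu>) simp
      also have "\<dots> = (norm ((sqrt \<mu> *\<^sub>R G j) *v y))\<^sup>2"
        using \<open>0 < \<mu>\<close> by (simp add: matrix_vector_scaleR_left power_mult_distrib power2_eq_square)
      finally show "(norm (?P *v y))\<^sup>2 \<le> (norm ((sqrt \<mu> *\<^sub>R G j) *v y))\<^sup>2" .
    qed simp
    ultimately have "x \<bullet> (pd_sqrt (A j) *v x) \<le> x \<bullet> ((sqrt \<mu> *\<^sub>R G j) *v x)"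
      by (intro pos_def_le_of_norm_le pos_def_pd_sqrt A j) auto
    then show ?thesis by (simp add: matrix_vector_scaleR_left)
  qed
  have "x \<bullet> (S *v x) \<le> sqrt \<mu> * (norm x)\<^sup>2" for x
  proof -
    have "x \<bullet> (S *v x) = (\<Sum>j=1..m. w j * (x \<bullet> (pd_sqrt (A j) *v x)))"
      by (simp add: S_def sum_matrix_vector inner_sum_right matrix_vector_scaleR_left)
    also have "\<dots> \<le> (\<Sum>j=1..m. w j * (sqrt \<mu> * (x \<bullet> (G j *v x))))"
      using w(1) le by (intro sum_mono mult_left_mono) auto
    also have "\<dots> = sqrt \<mu> * (x \<bullet> ((\<Sum>j=1..m. w j *\<^sub>R G j) *v x))"
      by (simp add: sum_matrix_vector inner_sum_right matrix_vector_scaleR_left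
          sum_distrib_left mult_ac)
    finally show ?thesis by (simp add: sum_G power2_norm_eq_inner)
  qed
  moreover have S: "pos_def_mat S" unfolding S_def by (rule pos_def_power_mean_root)
  ultimately have "S \<in> spectral_box 0 (sqrt \<mu>)"
    by (simp add: spectral_box_def pos_def_mat_hermitian pos_def_mat_nonneg)
  note bound = spectral_box_norm_le[OF order_refl this]
  \<comment> \<open>The bound for \<open>S\<close> is applied twice, and the two factors
    \<open>sqrt \<mu>\<close> multiply to \<open>\<mu>\<close>.\<close>
  have "norm (S *v (S *v x)) \<le> \<mu> * norm x" for x
  proof -
    have "norm (S *v (S *v x)) \<le> sqrt \<mu> * (sqrt \<mu> * norm x)"
      using \<open>0 < \<mu>\<close> by (intro order_trans[OF bound] mult_left_mono bound) simp
    then show ?thesis using \<open>0 < \<mu>\<close> by (simp flip: mult.assoc)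
  qed
  then have "onorm ((*v) (S ** S)) \<le> \<mu>"
    by (intro onorm_le) (simp flip: matrix_vector_mul_assoc)
  then show ?thesis
    by (simp add: power_mean_half_def Let_def \<mu>_def flip: S_def)
qed

end

section \<open>Existence of the barycenter\<close>

lemma spectral_box_mono: "a' \<le> a \<Longrightarrow> b \<le> b' \<Longrightarrow> spectral_box a b \<subseteq> spectral_box a' b'"
  by (auto simp: spectral_box_def intro: order_trans[OF mult_right_mono] order_trans[OF _ mult_right_mono])

lemma finite_pos_def_in_spectral_box:
  fixes A :: "'a \<Rightarrow> complex^'n^'n"
  assumes "finite J" "\<And>j. j \<in> J \<Longrightarrow> pos_def_mat (A j)"
  shows "\<exists>a>0. \<exists>b. \<forall>j\<in>J. A j \<in> spectral_box a b"
  using assms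
proof (induction J)
  case empty
  then show ?case by (auto intro: exI[of _ 1])
next
  case (insert i J)
  then obtain a b where ab: "0 < a" "\<And>j. j \<in> J \<Longrightarrow> A j \<in> spectral_box a b"
    by auto
  obtain c d where cd: "0 < c" "A i \<in> spectral_box c d"
    using pos_def_in_spectral_box insert.prems by blast
  have "A j \<in> spectral_box (min a c) (max b d)" if "j \<in> insert i J" for j
    using that ab(2) cd(2) spectral_box_mono[of "min a c" a b "max b d"]
      spectral_box_mono[of "min a c" c d "max b d"] by auto
  then show ?case
    using ab(1) cd(1) by (intro exI[of _ "min a c"] conjI exI[of _ "max b d"]) auto
qed

text \<open>For \<open>X\<close> and all \<open>A\<^sub>j\<close> between \<open>a I\<close> and
  \<open>b I\<close>, the congruences lie between \<open>a\<^sup>2 I\<close> and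
  \<open>b\<^sup>2 I\<close>. Their square roots return to the original interval, and so does the
  weighted average \<open>F X\<close>.\<close>

lemma ex_barycenter:
  fixes A :: "nat \<Rightarrow> complex^'n^'n"
  assumes A: "\<And>j. j \<in> {1..m} \<Longrightarrow> pos_def_mat (A j)"
    and w: "\<And>j. j \<in> {1..m} \<Longrightarrow> 0 \<le> w j" "(\<Sum>j=1..m. w j) = 1"
  obtains G \<Omega> where "barycenter m w A G \<Omega>"
proof -
  obtain a b where a: "0 < a" and box: "\<And>j. j \<in> {1..m} \<Longrightarrow> A j \<in> spectral_box a b"
    using finite_pos_def_in_spectral_box[of "{1..m}" A, OF finite_atLeastAtMost A] by blast
  define F where "F X = (\<Sum>j=1..m. w j *\<^sub>R pd_sqrt (pd_sqrt X ** A j ** pd_sqrt X))" for X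
  obtain j0 where j0: "j0 \<in> {1..m}"
    using w(2) by (metis sum.neutral zero_neq_one)
  have b: "0 < b"
  proof -
    obtain x :: "complex^'n" where "x \<noteq> 0"
      using zero_neq_one by metis
    moreover have "a * (norm x)\<^sup>2 \<le> b * (norm x)\<^sup>2"
      using box[OF j0] by (auto simp: spectral_box_def intro: order_trans)
    ultimately have "a \<le> b" by simp
    with a show ?thesis by simp
  qed
  have sandwich: "pd_sqrt X ** A j ** pd_sqrt X \<in> spectral_box (a * a) (b * b)"
    if X: "X \<in> spectral_box a b" and j: "j \<in> {1..m}" for X j
  proof -
    define Y where "Y = pd_sqrt X"
    have hY: "conj_transpose Y = Y" and YY: "Y ** Y = X"
      using spectral_box_imp_pos_def[OF a X]
      by (simp_all add: Y_def pos_def_mat_hermitian pos_def_pd_sqrt pd_sqrt_mult_self)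
    have "a * a * (norm x)\<^sup>2 \<le> x \<bullet> ((Y ** A j ** Y) *v x) \<and> x \<bullet> ((Y ** A j ** Y) *v x) \<le> b * b * (norm x)\<^sup>2" for x
    proof -
      have *: "x \<bullet> ((Y ** A j ** Y) *v x) = (Y *v x) \<bullet> (A j *v (Y *v x))"
        by (simp add: inner_matrix_vector[of x Y] hY flip: matrix_vector_mul_assoc)
      have **: "(norm (Y *v x))\<^sup>2 = x \<bullet> (X *v x)"
        by (simp add: inner_matrix_vector[of x Y] hY power2_norm_eq_inner
            flip: matrix_vector_mul_assoc YY)
      have "a * (norm x)\<^sup>2 \<le> (norm (Y *v x))\<^sup>2" "(norm (Y *v x))\<^sup>2 \<le> b * (norm x)\<^sup>2"
        unfolding ** using X by (simp_all add: spectral_box_def)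
      then have "a * (a * (norm x)\<^sup>2) \<le> a * (norm (Y *v x))\<^sup>2" "b * (norm (Y *v x))\<^sup>2 \<le> b * (b * (norm x)\<^sup>2)"
        using a b by (auto intro: mult_left_mono)
      moreover have "a * (norm (Y *v x))\<^sup>2 \<le> x \<bullet> ((Y ** A j ** Y) *v x)"
        "x \<bullet> ((Y ** A j ** Y) *v x) \<le> b * (norm (Y *v x))\<^sup>2"
        unfolding * using box[OF j] by (simp_all add: spectral_box_def)
      ultimately show ?thesis by (simp add: mult.assoc)
    qed
    moreover have "conj_transpose (A j) = A j"
      using A[OF j] by (rule pos_def_mat_hermitian)
    ultimately show ?thesis
      by (simp add: spectral_box_def conj_transpose_mult hY matrix_mul_assoc flip: Y_def)
  qed
  have in_box: "pd_sqrt (pd_sqrt X ** A j ** pd_sqrt X) \<in> spectral_box a b"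
    if "X \<in> spectral_box a b" "j \<in> {1..m}" for X j
    using pd_sqrt_in_spectral_box[OF _ sandwich[OF that]] a b by simp
  have "F \<in> spectral_box a b \<rightarrow> spectral_box a b"
    unfolding F_def using in_box w by (auto intro!: convex_sum convex_spectral_box)
  moreover have "continuous_on (spectral_box a b) F"
    unfolding F_def
  proof (intro continuous_on_sum continuous_on_scaleR continuous_on_const)
    fix j assume j: "j \<in> {1..m}"
    have f: "continuous_on (spectral_box a b) (\<lambda>X. pd_sqrt X ** A j ** pd_sqrt X)"
      by (intro continuous_on_matrix_mult continuous_on_pd_sqrt continuous_on_const a)
    \<comment> \<open>The positive lower bound \<open>a * a\<close> on the inner congruences is what
      gives continuity of the outer square root.\<close>
    have g: "continuous_on (spectral_box (a * a) (b * b)) (pd_sqrt :: complex^'n^'n \<Rightarrow> _)"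
      by (rule continuous_on_pd_sqrt) (simp add: a)
    show "continuous_on (spectral_box a b) (\<lambda>X. pd_sqrt (pd_sqrt X ** A j ** pd_sqrt X))"
      by (rule continuous_on_compose2[OF g f]) (use sandwich j in auto)
  qed
  moreover have "compact (spectral_box a b :: (complex^'n^'n) set)"
    using a by (intro compact_spectral_box) simp
  moreover have "spectral_box a b \<noteq> ({} :: (complex^'n^'n) set)"
    using box[OF j0] by auto
  ultimately obtain \<Omega> where "\<Omega> \<in> spectral_box a b" and fp: "F \<Omega> = \<Omega>"
    using brouwer[of "spectral_box a b" F] convex_spectral_box by metis
  then have \<Omega>: "pos_def_mat \<Omega>" using spectral_box_imp_pos_def[OF a] by blast
  have "\<forall>j. \<exists>G. j \<in> {1..m} \<longrightarrow> pos_def_mat G \<and> G ** \<Omega> ** G = A j \<and>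
      pd_sqrt \<Omega> ** G ** pd_sqrt \<Omega> = pd_sqrt (pd_sqrt \<Omega> ** A j ** pd_sqrt \<Omega>)"
    using ex_transport_map[OF \<Omega> A] by metis
  then obtain G where G: "\<And>j. j \<in> {1..m} \<Longrightarrow> pos_def_mat (G j) \<and> G j ** \<Omega> ** G j = A j \<and>
      pd_sqrt \<Omega> ** G j ** pd_sqrt \<Omega> = pd_sqrt (pd_sqrt \<Omega> ** A j ** pd_sqrt \<Omega>)"
    by metis
  define Y where "Y = pd_sqrt \<Omega>"
  have Y: "pos_def_mat Y" "Y ** Y = \<Omega>"
    using \<Omega> by (simp_all add: Y_def pos_def_pd_sqrt pd_sqrt_mult_self)
  obtain y where y: "Y ** y = mat 1" "y ** Y = mat 1"
    using pos_def_inverse[OF Y(1)] by metis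
  \<comment> \<open>The fixed-point equation reads
    \<open>Y (\<Sum>\<^sub>j w\<^sub>j G\<^sub>j) Y = Y Y\<close>; cancelling \<open>Y\<close> on
    both sides gives the averaging condition.\<close>
  have "Y ** (\<Sum>j=1..m. w j *\<^sub>R G j) ** Y = (\<Sum>j=1..m. w j *\<^sub>R (Y ** G j ** Y))"
    by (simp add: matrix_sum_ldistrib matrix_sum_rdistrib matrix_scaleR_left matrix_scaleR_right)
  also have "\<dots> = F \<Omega>"
    unfolding F_def Y_def using G by (intro sum.cong) auto
  finally have "y ** (Y ** (\<Sum>j=1..m. w j *\<^sub>R G j) ** Y) ** y = y ** (Y ** Y) ** y"
    by (simp add: fp Y(2))
  then have "(\<Sum>j=1..m. w j *\<^sub>R G j) = mat 1"
    by (simp add: matrix_mul_assoc y mult_cancel_inverse[OF y(1)])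
  with G \<Omega> A w have "barycenter m w A G \<Omega>"
    by unfold_locales auto
  then show ?thesis by (rule that)
qed

section \<open>The mean of two matrices and the final comparison\<close>

lemma diag_conj_linear:
  "a *\<^sub>R diag_conj U d + b *\<^sub>R diag_conj U e = diag_conj U (\<lambda>i. a * d i + b * e i)"
proof -
  have "real_diag (\<lambda>i. a * d i + b * e i) = a *\<^sub>R real_diag d + b *\<^sub>R real_diag e"
    by (simp add: real_diag_def vec_eq_iff of_real_def scaleR_add_left)
  then show ?thesis
    by (simp add: diag_conj_def matrix_ring_simps)
qed

text \<open>With \<open>K = w\<^sub>1 I + w\<^sub>2 G\<close>, the maps from
  \<open>K A\<^sub>1 K\<close> back to \<open>A\<^sub>1\<close> and on to \<open>A\<^sub>2\<close>
  are the inverse of \<open>K\<close> and \<open>G\<close> times that inverse. Both are functions of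
  \<open>G\<close>, and their weighted sum is \<open>K\<close> times its inverse.\<close>

lemma two_point_barycenter:
  fixes A :: "nat \<Rightarrow> complex^'n^'n"
  assumes A: "pos_def_mat (A 1)" "pos_def_mat (A 2)" and w: "0 \<le> w 1" "0 \<le> w 2" "w 1 + w 2 = 1"
    and G: "pos_def_mat G" "G ** A 1 ** G = A 2"
  obtains H where "barycenter 2 w A H ((w 1 *\<^sub>R mat 1 + w 2 *\<^sub>R G) ** A 1 ** (w 1 *\<^sub>R mat 1 + w 2 *\<^sub>R G))"
proof -
  obtain U d where Ud: "conj_transpose U ** U = mat 1" "G = diag_conj U d" "\<And>i. 0 < d i"
    using pos_def_spectral[OF G(1)] by metis
  have pos: "0 < w 1 + w 2 * d i" for i
  proof (cases "w 1 = 0")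
    case True
    with w Ud(3)[of i] show ?thesis by simp
  next
    case False
    with w Ud(3)[of i] show ?thesis by (intro add_pos_nonneg) (auto intro: less_imp_le)
  qed
  define K where "K = w 1 *\<^sub>R mat 1 + w 2 *\<^sub>R G"
  define T where "T = diag_conj U (\<lambda>i. 1 / (w 1 + w 2 * d i))"
  define T' where "T' = diag_conj U (\<lambda>i. d i / (w 1 + w 2 * d i))"
  have K: "K = diag_conj U (\<lambda>i. w 1 + w 2 * d i)"
    using diag_conj_linear[of "w 1" U "\<lambda>i. 1" "w 2" d] by (simp add: K_def diag_conj_1[OF Ud(1)] Ud(2))
  have nz: "w 1 + w 2 * d i \<noteq> 0" for i using pos[of i] by simp
  have TK: "T ** K = mat 1" "K ** T = mat 1" "T' ** K = G" "K ** T' = G"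
    by (simp_all add: T_def T'_def K diag_conj_mult[OF Ud(1)] nz diag_conj_1[OF Ud(1)] Ud(2))
  have hK: "conj_transpose K = K"
    by (simp add: K conj_transpose_diag_conj)
  have J: "{1..2::nat} = {1, 2}" by auto
  have "barycenter 2 w A (\<lambda>j. if j = 1 then T else T') (K ** A 1 ** K)"
  proof
    show "pos_def_mat (K ** A 1 ** K)"
      using pos_def_mat_congruence[OF A(1) TK(1)] hK by simp
    show "pos_def_mat (if j = 1 then T else T')" if "j \<in> {1..2}" for j
      using pos Ud by (auto simp: T_def T'_def intro!: pos_def_diag_conj)
    show "(if j = 1 then T else T') ** (K ** A 1 ** K) ** (if j = 1 then T else T') = A j"
      if "j \<in> {1..2}" for j
    proof -
      have "T ** (K ** A 1 ** K) ** T = A 1"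
        by (simp add: matrix_mul_assoc TK mult_cancel_inverse[OF TK(2)])
      moreover have "T' ** (K ** A 1 ** K) ** T' = A 2"
        by (simp add: matrix_mul_assoc TK mult_assoc_subst[OF TK(4)] G(2))
      ultimately show ?thesis using that by (auto simp: J)
    qed
    have "w 1 *\<^sub>R T + w 2 *\<^sub>R T' = mat 1"
    proof -
      have "w 1 * (1 / (w 1 + w 2 * d i)) + w 2 * (d i / (w 1 + w 2 * d i)) = 1" for i
        using nz[of i] by (simp flip: add_divide_distrib)
      then show ?thesis
        unfolding T_def T'_def diag_conj_linear by (simp add: diag_conj_1[OF Ud(1)])
    qed
    then show "(\<Sum>j=1..2. w j *\<^sub>R (if j = 1 then T else T')) = mat 1"
      by (simp add: J)
  qed (use A w in \<open>auto simp: J\<close>)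
  then show ?thesis
    unfolding K_def by (rule that)
qed

theorem theorem2:
  fixes m :: nat and w :: "nat \<Rightarrow> real" and A :: "nat \<Rightarrow> complex^'n^'n"
  assumes "\<And>j. j \<in> {1..m} \<Longrightarrow> pos_def_mat (A j)"
    and "\<And>j. j \<in> {1..m} \<Longrightarrow> 0 \<le> w j"
    and "(\<Sum>j=1..m. w j) = 1"
  shows "(\<forall>p\<in>{1, \<infinity>}. schatten_norm p (power_mean_half m w A)
                        \<le> schatten_norm p (wasserstein_mean m w A))
       \<and> (m = 2 \<longrightarrow> schatten_norm 2 (power_mean_half m w A)
                        \<le> schatten_norm 2 (wasserstein_mean m w A))"
proof -
  obtain G \<Omega> where "barycenter m w A G \<Omega>"
    by (rule ex_barycenter[OF assms])
  then interpret barycenter m w A G \<Omega> .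
  have "schatten_norm 1 (power_mean_half m w A) \<le> schatten_norm 1 (wasserstein_mean m w A)"
    unfolding wasserstein_mean_eq
    by (simp add: schatten_norm_1_pos_def pos_def_power_mean \<Omega> rtr_power_mean_le)
  moreover have "schatten_norm \<infinity> (power_mean_half m w A) \<le> schatten_norm \<infinity> (wasserstein_mean m w A)"
    unfolding wasserstein_mean_eq schatten_norm_inf by (rule onorm_power_mean_le)
  moreover have "schatten_norm 2 (power_mean_half m w A) \<le> schatten_norm 2 (wasserstein_mean m w A)"
    if m: "m = 2"
  proof -
    have J: "{1..m} = {1, 2}" using m by auto
    have A12: "pos_def_mat (A 1)" "pos_def_mat (A 2)" and w12: "0 \<le> w 1" "0 \<le> w 2" "w 1 + w 2 = 1"
      using assms unfolding J by auto
    define P R where "P = pd_sqrt (A 1)" and "R = pd_sqrt (A 2)"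
    have P: "pos_def_mat P" "P ** P = A 1" and R: "pos_def_mat R" "R ** R = A 2"
      using A12 by (simp_all add: P_def R_def pos_def_pd_sqrt pd_sqrt_mult_self)
    \<comment> \<open>From here on \<open>G\<close> is the single map taking \<open>A 1\<close> to
      \<open>A 2\<close>, not the family of maps starting at \<open>\<Omega>\<close>.\<close>
    obtain G where G: "pos_def_mat G" "G ** A 1 ** G = A 2"
      using ex_transport_map[OF A12] by metis
    have Q: "power_mean_half m w A
        = (w 1)\<^sup>2 *\<^sub>R (P ** P) + (w 2)\<^sup>2 *\<^sub>R (R ** R) + (w 1 * w 2) *\<^sub>R (P ** R + R ** P)"
      by (simp add: power_mean_half_def J Let_def matrix_ring_simps power2_eq_square scaleR_add_right
          flip: P_def R_def)
    let ?K = "w 1 *\<^sub>R mat 1 + w 2 *\<^sub>R G"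
    \<comment> \<open>A second certificate, now for the closed form; uniqueness of the minimizer
      identifies it with the mean.\<close>
    obtain H where "barycenter m w A H (?K ** A 1 ** ?K)"
      using two_point_barycenter[OF A12 w12 G] unfolding m by metis
    then have "wasserstein_mean m w A = ?K ** A 1 ** ?K"
      by (rule barycenter.wasserstein_mean_eq)
    also have "\<dots> = (w 1)\<^sup>2 *\<^sub>R A 1 + (w 2)\<^sup>2 *\<^sub>R A 2 + (w 1 * w 2) *\<^sub>R (A 1 ** G + G ** A 1)"
      by (simp add: matrix_ring_simps power2_eq_square scaleR_add_right G(2))
    finally have W: "wasserstein_mean m w A
        = (w 1)\<^sup>2 *\<^sub>R (P ** P) + (w 2)\<^sup>2 *\<^sub>R (R ** R) + (w 1 * w 2) *\<^sub>R (P ** P ** G + G ** (P ** P))"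
      by (simp add: P(2) R(2))
    have "rtr (power_mean_half m w A ** power_mean_half m w A)
        \<le> rtr (wasserstein_mean m w A ** wasserstein_mean m w A)"
      unfolding Q W using rtr_square_two_point_le[OF P(1) R(1) G(1) _ w12(1,2)] G(2)
      by (simp add: P(2) R(2))
    moreover have "pos_def_mat (wasserstein_mean m w A)"
      by (simp add: wasserstein_mean_eq \<Omega>)
    ultimately show ?thesis
      unfolding schatten_norm_2_pos_def[OF pos_def_power_mean] by (subst schatten_norm_2_pos_def) auto
  qed
  ultimately show ?thesis by blast
qed

end
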